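(* Let $Z$ be a Banach space, $\beta\in(1,2)$, $m\ge 1$ an integer, and $0=u_0<t_1<u_1<t_2<\dots<t_m<u_m<t_{m+1}=u_{m+1}=a$. Let $A:D(A)\subseteq Z\to Z$ be the generator of a Riemann-Liouville $\beta$-order fractional resolvent $\{\mathcal R_\beta(t)\mid t>0\}\subset\mathcal L(Z)$, and suppose there is a constant $\lambda_{\mathcal R}$ such that $\|t^{2-\beta}\mathcal R_\beta(t)\|\le\lambda_{\mathcal R}$ for $t\in(0,a]$. Let $h:[0,a]\times Z\to Z$, $\varphi_j:[t_j,u_j]\times Z\to Z$ ($j=1,\dots,m$), $z_0\in Z$ and $\widetilde z_j\in Z$ ($j=0,1,\dots,m$) be given. Consider the system $$\begin{aligned} &{}_{0}D_t^{\beta}z(t)=Az(t)+h(t,z(t)),\quad t\in\textstyle\bigcup_{j=0}^m(u_j,t_{j+1}],\\ &z(t)=\varphi_j(t,z(t_j^-)),\quad t\in(t_j,u_j],\ j=1,\dots,m,\\ &{}_{u_j}I_t^{2-\beta}z(t)|_{t=u_j}=\frac1{u_j-t_j}\int_{t_j}^{u_j}\varphi_j(r,z(t_j))\,dr,\quad j=1,\dots,m,\\ &{}_{0}I_t^{2-\beta}z(t)|_{t=0}=z_0,\\ &{}_{u_j}D_t^{\beta-1}z(t)|_{t=u_j}=\widetilde z_j,\quad j=0,1,\dots,m. \end{aligned}$$ Assume: (A1) $q<\frac{1}{2-\beta}$, where $q$ is the exponent of the space $L^q([0,a];Z)$. (A2) There is a constant $\lambda_h>0$ such that $\|h(t,z)-h(t,y)\|_Z\le\lambda_h\|z-y\|_Z$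 for all $z,y\in Z$ (and all $t$). (A3) For $j=1,\dots,m$, $\varphi_j:[t_j,u_j]\times Z\to Z$ is continuous and there is a constant $\lambda_{\varphi_j}\in(0,1]$ such that $\|\varphi_j(t,z)-\varphi_j(t,y)\|_Z\le\lambda_{\varphi_j}\|z-y\|_Z$ (for all $t\in[t_j,u_j]$, $z,y\in Z$). (A4) For $j=1,\dots,m$, $\varphi_j$ is of the order $(u_j-t)^{1+\beta}$, i.e. $\varphi_j(t,z)=(u_j-t)^{1+\beta}\psi_j(t,z)$, where $\psi_j$ satisfies $\|\psi_j(t,z)-\psi_j(t,y)\|_Z\le\lambda_{\psi_j}\|z-y\|_Z$ for all $z,y\in Z$ (and all $t$), with a constant $\lambda_{\psi_j}\in(0,1]$. (A5) For every $j=1,\dots,m$, one has $c<1$, where $$\begin{aligned} c={}&\frac{\lambda_{\mathcal R}\lambda_{\varphi_j}}{(t_j-u_{j-1})^{2-\beta}}+\frac{\lambda_{\mathcal R}\lambda_h(\Gamma(\beta-1))^2(t_{j+1}-u_j)^\beta}{\Gamma(2\beta-1)}+\frac{\lambda_{\mathcal R}}{(\beta-1)\Gamma(2-\beta)}\sum_{k=0}^{j-1}\left(\frac{t_{k+1}-u_k}{u_j-t_{k+1}}\right)^{\beta-1}\\ &+\frac{\lambda_{\mathcal R}}{\beta\,\Gamma(2-\beta)}\sum_{k=0}^{j-2}\frac{\lambda_{\varphi_{k+1}}(t_{j+1}-u_j)^2}{(t_{k+1}-u_k)^{2-\beta}(u_j-u_{k+1})^\beta}+\frac{\lambda_{\mathcal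 R}\lambda_{\psi_j}(t_{j+1}-u_j)^2}{\Gamma(2-\beta)(t_j-u_{j-1})^{2-\beta}}. \end{aligned}$$ Then the system admits a unique mild solution in $PC_{2-\beta}([0,a];Z)$.
   Context: **Fractional integral and derivative.** For $\alpha>0$, ${}_{t_0}I_t^\alpha z(t)=\frac1{\Gamma(\alpha)}\int_{t_0}^t(t-r)^{\alpha-1}z(r)\,dr$. For $0\le n-1<\alpha<n$, the Riemann-Liouville derivative is ${}_{t_0}D_t^\alpha z(t)=\frac1{\Gamma(n-\alpha)}\left(\frac{d}{dt}\right)^n\int_{t_0}^t(t-r)^{n-\alpha-1}z(r)\,dr$. When the lower limit is omitted ($I_t^\beta$), it is $0$. **Fractional resolvent.** $\mathcal L(Z)$ denotes the bounded linear operators on $Z$. A family $\{\mathcal R_\beta(t)\mid t>0\}\subset\mathcal L(Z)$ is a Riemann-Liouville $\beta$-order fractional resolvent if: (i) for every $z\in Z$, $\mathcal R_\beta(\cdot)z\in C((0,\infty);Z)$ and $\lim_{t\to0^+}\Gamma(\beta-1)t^{2-\beta}\mathcal R_\beta(t)z=z$; (ii) $\mathcal R_\beta(r)$ and $\mathcal R_\beta(t)$ commute for $r,t>0$; (iii) for $r,t>0$, $$\mathcal R_\beta(r)I_t^\beta\mathcal R_\beta(t)-I_r^\beta\mathcal R_\beta(r)\mathcal R_\beta(t)=\frac{r^{\beta-2}}{\Gamma(\beta-1)}I_t^\beta\mathcal R_\beta(t)-\frac{t^{\beta-2}}{\Gamma(\beta-1)}I_r^\beta\mathcal R_\beta(r).$$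 Its generator $A$ is $$Az=\Gamma(2\beta-1)\lim_{t\to0^+}\frac{t^{2-\beta}\mathcal R_\beta(t)z-\frac1{\Gamma(\beta-1)}z}{t^\beta},$$ with domain $D(A)$ the set of $z\in Z$ for which this limit exists. **One-sided limits.** $z(t_j)=z(t_j^-)=\lim_{\triangle\to0^+}z(t_j-\triangle)$. **The space $PC_{2-\beta}([0,a];Z)$.** It consists of the functions $z$ that are continuous, with values in $Z$, on $\bigcup_{j=0}^m(u_j,t_{j+1})\cup\bigcup_{j=1}^m(t_j,u_j)$, such that: for $j=1,\dots,m$ the left limits $z(u_j^-)$ and $z(t_j^-)$ exist (finite) and $z(u_j)=z(u_j^-)$, $z(t_j)=z(t_j^-)$; and, for $j=0,1,\dots,m$, $(t-u_j)^{2-\beta}\|z(t)\|$ is bounded on $(u_j,u_{j+1}]$. It is normed by $\|z\|_{[0,a]}=\max_{j=0,\dots,m}\|z\|_j$, where $\|z\|_j=\sup_{t\in(u_j,u_{j+1}]}(t-u_j)^{2-\beta}\|z(t)\|$. **Mild solution.** A function $z\in PC_{2-\beta}([0,a];Z)$ is a mild solution of the system if - for $t\in(0,t_1]$: $z(t)=\mathcal R_\beta(t)z_0+\int_0^t\mathcal R_\beta(r)\widetilde z_0\,dr+\int_0^t\int_0^{t-r}\mathcal R_\beta(\phi)h(r,z(r))\,d\phi\,dr$; - for $t\in(t_j,u_j]$, $j=1,\dots,m$: $z(t)=\varphi_j(t,z(t_j^-))$; - for $t\in(u_j,t_{j+1}]$, $j=1,\dots,m$: $$z(t)=\frac{\mathcal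 R_\beta(t-u_j)}{u_j-t_j}\int_{t_j}^{u_j}\varphi_j(r,z(t_j))\,dr+\int_{u_j}^t\mathcal R_\beta(r-u_j)\widetilde z_j\,dr+\int_{u_j}^t\int_0^{t-r}\mathcal R_\beta(\phi)\big(h(r,z(r))-\Phi_j(r,z(r))\big)\,d\phi\,dr,$$ where, for $j=1,\dots,m$, $$\Phi_j(t,z(t))=\frac{\beta(\beta-1)}{\Gamma(2-\beta)}\sum_{k=0}^{j-1}\left(\int_{u_k}^{t_{k+1}}\frac{z(r)}{(t-r)^{1+\beta}}\,dr+\int_{t_{k+1}}^{u_{k+1}}\frac{\varphi_{k+1}(r,z(t_{k+1}))}{(t-r)^{1+\beta}}\,dr\right).$$ Integrals of $Z$-valued functions are Bochner integrals. An empty sum is $0$.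
   Formalization: (A1) is read as 1 ≤ q < 1/(2-β) with h(·,z) in L^q([0,a];Z) for each fixed z, as otherwise the integrals of h may not exist; (A4) also includes ‖φ_j(t,z)‖ = O((u_j-t)^{1+β}) as t→u_j^- for each z; uniqueness means equality on (0,a]. *)

theory Defs
  imports "HOL-Analysis.Analysis" "HOL-Library.Landau_Symbols"
begin

text \<open>
  The library's Bochner integral is restricted to second countable (separable) target spaces.
  The definitions below repeat it for an arbitrary normed space; strong measurability replaces
  Borel measurability, which is too weak in a non-separable space.
\<close>

definition strongly_measurable :: "'b measure \<Rightarrow> ('b \<Rightarrow> 'a::real_normed_vector) \<Rightarrow> bool" where
  "strongly_measurable M f \<longleftrightarrow>
    (\<exists>s. (\<forall>i. simple_function M (s i)) \<and> (AE x in M. (\<lambda>i::nat. s i x) \<longlonglongrightarrow> f x))"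

definition has_bint :: "'b measure \<Rightarrow> ('b \<Rightarrow> 'a::real_normed_vector) \<Rightarrow> 'a \<Rightarrow> bool" where
  "has_bint M f v \<longleftrightarrow> strongly_measurable M f \<and>
    (\<exists>s. (\<forall>i. Bochner_Integration.simple_bochner_integrable M (s i)) \<and>
         (\<lambda>i::nat. \<integral>\<^sup>+x. ennreal (norm (f x - s i x)) \<partial>M) \<longlonglongrightarrow> 0 \<and>
         (\<lambda>i. Bochner_Integration.simple_bochner_integral M (s i)) \<longlonglongrightarrow> v)"

definition bint_on :: "real set \<Rightarrow> (real \<Rightarrow> 'a::real_normed_vector) \<Rightarrow> 'a" where
  "bint_on S f = (if \<exists>v. has_bint (lebesgue_on S) f v
                  then THE v. has_bint (lebesgue_on S) f v else 0)"

definition bintegrable_on :: "real set \<Rightarrow> (real \<Rightarrow> 'a::real_normed_vector) \<Rightarrow> bool" where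
  "bintegrable_on S f \<longleftrightarrow> (\<exists>v. has_bint (lebesgue_on S) f v)"

definition Lq_space :: "real \<Rightarrow> real set \<Rightarrow> (real \<Rightarrow> 'a::real_normed_vector) set" where
  "Lq_space q S = {f. strongly_measurable (lebesgue_on S) f \<and>
                      (\<integral>\<^sup>+x. ennreal (norm (f x) powr q) \<partial>lebesgue_on S) < \<infinity>}"

definition rl_integral :: "real \<Rightarrow> real \<Rightarrow> (real \<Rightarrow> 'a::real_normed_vector) \<Rightarrow> real \<Rightarrow> 'a" where
  "rl_integral \<alpha> t0 z t =
     (1 / Gamma \<alpha>) *\<^sub>R bint_on {t0..t} (\<lambda>r. (t - r) powr (\<alpha> - 1) *\<^sub>R z r)"

text \<open>
  Only the values \<open>R t\<close> with \<open>t > 0\<close> matter. The operator identity (third part) is read pointwise,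
  with the fractional integral of an operator family taken in the strong sense.
\<close>

definition rl_resolvent :: "real \<Rightarrow> (real \<Rightarrow> 'a::real_normed_vector \<Rightarrow>\<^sub>L 'a) \<Rightarrow> bool" where
  "rl_resolvent \<beta> R \<longleftrightarrow>
    (\<forall>z. continuous_on {0<..} (\<lambda>t. blinfun_apply (R t) z) \<and>
         ((\<lambda>t. (Gamma (\<beta> - 1) * t powr (2 - \<beta>)) *\<^sub>R blinfun_apply (R t) z) \<longlongrightarrow> z) (at_right 0)) \<and>
    (\<forall>r>0. \<forall>t>0. R r o\<^sub>L R t = R t o\<^sub>L R r) \<and>
    (\<forall>r>0. \<forall>t>0. \<forall>z.
       blinfun_apply (R r) (rl_integral \<beta> 0 (\<lambda>s. blinfun_apply (R s) z) t)
         - rl_integral \<beta> 0 (\<lambda>s. blinfun_apply (R s) (blinfun_apply (R t) z)) r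
       = (r powr (\<beta> - 2) / Gamma (\<beta> - 1)) *\<^sub>R rl_integral \<beta> 0 (\<lambda>s. blinfun_apply (R s) z) t
         - (t powr (\<beta> - 2) / Gamma (\<beta> - 1)) *\<^sub>R rl_integral \<beta> 0 (\<lambda>s. blinfun_apply (R s) z) r)"

definition rl_difference_quotient ::
    "real \<Rightarrow> (real \<Rightarrow> 'a::real_normed_vector \<Rightarrow>\<^sub>L 'a) \<Rightarrow> 'a \<Rightarrow> real \<Rightarrow> 'a" where
  "rl_difference_quotient \<beta> R z t =
     (1 / t powr \<beta>) *\<^sub>R
       (t powr (2 - \<beta>) *\<^sub>R blinfun_apply (R t) z - (1 / Gamma (\<beta> - 1)) *\<^sub>R z)"

text \<open>The unbounded operator is given by its domain \<open>D\<close> and a function \<open>A\<close> relevant on \<open>D\<close> only.\<close>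

definition rl_generator ::
    "real \<Rightarrow> (real \<Rightarrow> 'a::real_normed_vector \<Rightarrow>\<^sub>L 'a) \<Rightarrow> 'a set \<Rightarrow> ('a \<Rightarrow> 'a) \<Rightarrow> bool" where
  "rl_generator \<beta> R D A \<longleftrightarrow>
     D = {z. \<exists>l. (rl_difference_quotient \<beta> R z \<longlongrightarrow> l) (at_right 0)} \<and>
     (\<forall>z\<in>D. A z = Gamma (2 * \<beta> - 1) *\<^sub>R Lim (at_right 0) (rl_difference_quotient \<beta> R z))"

definition partition_points :: "nat \<Rightarrow> real \<Rightarrow> (nat \<Rightarrow> real) \<Rightarrow> (nat \<Rightarrow> real) \<Rightarrow> bool" where
  "partition_points m a u t \<longleftrightarrow>
     u 0 = 0 \<and> (\<forall>j\<le>m. u j < t (j + 1)) \<and> (\<forall>j\<in>{1..m}. t j < u j) \<and>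
     t (m + 1) = a \<and> u (m + 1) = a"

text \<open>
  The value at \<open>0\<close> is not constrained and not seen by the norm of the space,
  so its elements are effectively functions on \<open>{0<..u (m + 1)}\<close>.
\<close>

definition PC_space ::
    "real \<Rightarrow> nat \<Rightarrow> (nat \<Rightarrow> real) \<Rightarrow> (nat \<Rightarrow> real) \<Rightarrow> (real \<Rightarrow> 'a::real_normed_vector) set" where
  "PC_space \<beta> m u t = {z.
     continuous_on ((\<Union>j\<in>{0..m}. {u j<..<t (j + 1)}) \<union> (\<Union>j\<in>{1..m}. {t j<..<u j})) z \<and>
     (\<forall>j\<in>{1..m}. (z \<longlongrightarrow> z (u j)) (at_left (u j)) \<and> (z \<longlongrightarrow> z (t j)) (at_left (t j))) \<and>
     (\<forall>j\<in>{0..m}. bdd_above ((\<lambda>s. (s - u j) powr (2 - \<beta>) * norm (z s)) ` {u j<..u (j + 1)}))}"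

definition Phi_hist ::
    "real \<Rightarrow> (nat \<Rightarrow> real) \<Rightarrow> (nat \<Rightarrow> real) \<Rightarrow> (nat \<Rightarrow> real \<Rightarrow> 'a \<Rightarrow> 'a::real_normed_vector)
      \<Rightarrow> nat \<Rightarrow> (real \<Rightarrow> 'a) \<Rightarrow> real \<Rightarrow> 'a" where
  "Phi_hist \<beta> u t \<phi> j z s =
     (\<beta> * (\<beta> - 1) / Gamma (2 - \<beta>)) *\<^sub>R
     (\<Sum>k<j. bint_on {u k..t (k + 1)} (\<lambda>r. (1 / (s - r) powr (1 + \<beta>)) *\<^sub>R z r)
           + bint_on {t (k + 1)..u (k + 1)}
               (\<lambda>r. (1 / (s - r) powr (1 + \<beta>)) *\<^sub>R \<phi> (k + 1) r (z (t (k + 1)))))"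

text \<open>
  The integrability conditions say that the integrals of the nonlinear terms exist, so that the
  default value of \<^const>\<open>bint_on\<close> plays no role. The other integrals exist because of
  the resolvent axioms, the continuity of \<open>\<phi>\<close> and the definition of \<^const>\<open>PC_space\<close>.
\<close>

definition mild_solution ::
    "real \<Rightarrow> nat \<Rightarrow> (nat \<Rightarrow> real) \<Rightarrow> (nat \<Rightarrow> real) \<Rightarrow> (real \<Rightarrow> 'a::real_normed_vector \<Rightarrow>\<^sub>L 'a)
      \<Rightarrow> (real \<Rightarrow> 'a \<Rightarrow> 'a) \<Rightarrow> (nat \<Rightarrow> real \<Rightarrow> 'a \<Rightarrow> 'a) \<Rightarrow> 'a \<Rightarrow> (nat \<Rightarrow> 'a)
      \<Rightarrow> (real \<Rightarrow> 'a) \<Rightarrow> bool" where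
  "mild_solution \<beta> m u t R h \<phi> z0 zt z \<longleftrightarrow>
     z \<in> PC_space \<beta> m u t \<and>
     (\<forall>s\<in>{0<..t 1}.
        bintegrable_on {0..s} (\<lambda>r. bint_on {0..s - r} (\<lambda>p. blinfun_apply (R p) (h r (z r)))) \<and>
        z s = blinfun_apply (R s) z0
            + bint_on {0..s} (\<lambda>r. blinfun_apply (R r) (zt 0))
            + bint_on {0..s} (\<lambda>r. bint_on {0..s - r} (\<lambda>p. blinfun_apply (R p) (h r (z r))))) \<and>
     (\<forall>j\<in>{1..m}. \<forall>s\<in>{t j<..u j}. z s = \<phi> j s (Lim (at_left (t j)) z)) \<and>
     (\<forall>j\<in>{1..m}. \<forall>s\<in>{u j<..t (j + 1)}.
        bintegrable_on {u j..s} (\<lambda>r. bint_on {0..s - r}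
          (\<lambda>p. blinfun_apply (R p) (h r (z r) - Phi_hist \<beta> u t \<phi> j z r))) \<and>
        z s = (1 / (u j - t j)) *\<^sub>R
                blinfun_apply (R (s - u j)) (bint_on {t j..u j} (\<lambda>r. \<phi> j r (z (t j))))
            + bint_on {u j..s} (\<lambda>r. blinfun_apply (R (r - u j)) (zt j))
            + bint_on {u j..s} (\<lambda>r. bint_on {0..s - r}
                (\<lambda>p. blinfun_apply (R p) (h r (z r) - Phi_hist \<beta> u t \<phi> j z r))))"

text \<open>The range \<open>k < j - 1\<close> of the second sum is empty for \<open>j = 1\<close>.\<close>

definition contraction_const ::
    "real \<Rightarrow> (nat \<Rightarrow> real) \<Rightarrow> (nat \<Rightarrow> real) \<Rightarrow> real \<Rightarrow> real \<Rightarrow> (nat \<Rightarrow> real) \<Rightarrow> (nat \<Rightarrow> real)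
      \<Rightarrow> nat \<Rightarrow> real" where
  "contraction_const \<beta> u t lR lh l\<phi> l\<psi> j =
     lR * l\<phi> j / (t j - u (j - 1)) powr (2 - \<beta>)
   + lR * lh * (Gamma (\<beta> - 1))\<^sup>2 * (t (j + 1) - u j) powr \<beta> / Gamma (2 * \<beta> - 1)
   + lR / ((\<beta> - 1) * Gamma (2 - \<beta>)) *
       (\<Sum>k<j. ((t (k + 1) - u k) / (u j - t (k + 1))) powr (\<beta> - 1))
   + lR / (\<beta> * Gamma (2 - \<beta>)) *
       (\<Sum>k<j - 1. l\<phi> (k + 1) * (t (j + 1) - u j)\<^sup>2 /
          ((t (k + 1) - u k) powr (2 - \<beta>) * (u j - u (k + 1)) powr \<beta>))
   + lR * l\<psi> j * (t (j + 1) - u j)\<^sup>2 /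
       (Gamma (2 - \<beta>) * (t j - u (j - 1)) powr (2 - \<beta>))"

end

theory Submission
  imports Defs
begin

text \<open>
  On each interval \<open>(u j, t (j + 1)]\<close> the history term \<open>\<Phi>\<^sub>j\<close> and the initial value depend only on the
  solution up to time \<open>t j\<close>, so the mild equation is a Volterra equation
  \<open>z s = f s + \<integral> S (s - r) (h r (z r) - \<Phi>\<^sub>j r) dr\<close> whose kernel \<open>S x = \<integral> R\<close> over \<open>[0, x]\<close> is
  bounded, because the singularity \<open>s powr (\<beta> - 2)\<close> of the resolvent is integrable. Such an equation
  is uniquely solvable for every Lipschitz constant: the difference \<open>z - f\<close> is continuous up to
  \<open>u j\<close> and is the fixed point of a map that contracts an exponentially weighted supremum norm.
  The solution is obtained by gluing the pieces. Near \<open>s = u j\<close> the history term stays bounded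
  because \<open>\<phi> j\<close> vanishes at \<open>u j\<close> to the order \<open>1 + \<beta>\<close> of the kernel singularity.
\<close>

section \<open>Bochner integration in arbitrary Banach spaces\<close>

text \<open>The unknown is split because the forcing \<open>f\<close> is in general unbounded at
  \<open>u j\<close>, where it starts like \<open>R (s - u j)\<close> applied to a nonzero vector: a
  supremum norm can measure only the remainder \<open>w = z - f\<close>, while \<open>f\<close>
  enters as an integrable function. Two points of measure theory shape the rest. In a non-separable
  space measurability has to mean being an a.e. limit of simple functions, and the norm of such a
  function is Borel only up to a null set; Borel representatives replace norms before additivity or
  convergence theorems for the nonnegative integral are applied. And the integrands
  \<open>S (s - r) (g r)\<close> and \<open>h r (z r)\<close> are known only slice by slice,
  measurable in time and Lipschitz in the vector; their measurability comes from a Caratheodory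
  argument, which rests on stability of strong measurability under a.e. limits.\<close>

lemma strongly_measurable_everywhere:
  fixes f :: "'b \<Rightarrow> 'a::real_normed_vector"
  assumes "strongly_measurable M f"
  obtains f' s where "\<And>i::nat. simple_function M (s i)"
    "\<And>x. x \<in> space M \<Longrightarrow> (\<lambda>i. s i x) \<longlonglongrightarrow> f' x" "AE x in M. f x = f' x"
proof -
  obtain s where s: "\<And>i::nat. simple_function M (s i)" "AE x in M. (\<lambda>i. s i x) \<longlonglongrightarrow> f x"
    using assms unfolding strongly_measurable_def by blast
  from s(2) obtain N where N: "{x \<in> space M. \<not> (\<lambda>i. s i x) \<longlonglongrightarrow> f x} \<subseteq> N"
      "emeasure M N = 0" "N \<in> sets M"
    by (rule AE_E)
  \<comment> \<open>The simple functions and their limit are set to 0 on the exceptional null set,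
    so that convergence holds at every point, as Borel measurability of a pointwise limit
    requires.\<close>
  have "simple_function M (\<lambda>x. if x \<in> N then 0 else s i x)" for i
    using s(1) N(3) by (intro simple_function_If_set) auto
  moreover have "(\<lambda>i. if x \<in> N then 0 else s i x) \<longlonglongrightarrow> (if x \<in> N then 0 else f x)"
    if "x \<in> space M" for x
    using N(1) that by auto
  moreover have "AE x in M. f x = (if x \<in> N then 0 else f x)"
    using N by (intro AE_I'[of N]) auto
  ultimately show thesis
    using that[of "\<lambda>i x. if x \<in> N then 0 else s i x" "\<lambda>x. if x \<in> N then 0 else f x"] by blast
qed

text \<open>For a measure that is not complete, \<open>norm (f x)\<close> may fail to be Borel on
  the exceptional null set. The nonnegative integral of a non-measurable function is only a lower
  integral, without additivity, so later proofs pass to this \<open>g\<close> first.\<close>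

lemma strongly_measurable_norm_AE:
  fixes f :: "'b \<Rightarrow> 'a::real_normed_vector"
  assumes "strongly_measurable M f"
  obtains g :: "'b \<Rightarrow> real" where "g \<in> borel_measurable M" "AE x in M. norm (f x) = g x"
    "\<And>x. 0 \<le> g x"
proof -
  obtain f' s where s: "\<And>i::nat. simple_function M (s i)"
    "\<And>x. x \<in> space M \<Longrightarrow> (\<lambda>i. s i x) \<longlonglongrightarrow> f' x" "AE x in M. f x = f' x"
    using strongly_measurable_everywhere[OF assms, of thesis] by blast
  have "(\<lambda>x. norm (f' x)) \<in> borel_measurable M"
  proof (rule borel_measurable_LIMSEQ_metric)
    show "(\<lambda>x. norm (s i x)) \<in> borel_measurable M" for i
      by (rule borel_measurable_simple_function[OF simple_function_compose1[OF s(1)]])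
    show "(\<lambda>i. norm (s i x)) \<longlonglongrightarrow> norm (f' x)" if "x \<in> space M" for x
      by (intro tendsto_norm s(2) that)
  qed
  moreover have "AE x in M. norm (f x) = norm (f' x)"
    using s(3) by auto
  ultimately show thesis
    using that[of "\<lambda>x. norm (f' x)"] by simp
qed

lemma strongly_measurable_simple_function:
  "simple_function M f \<Longrightarrow> strongly_measurable M f"
  unfolding strongly_measurable_def by (intro exI[of _ "\<lambda>_. f"]) auto

lemma strongly_measurable_cong_AE:
  assumes "AE x in M. f x = g x" "strongly_measurable M f"
  shows "strongly_measurable M g"
proof -
  obtain s where s: "\<And>i::nat. simple_function M (s i)" "AE x in M. (\<lambda>i. s i x) \<longlonglongrightarrow> f x"
    using assms(2) unfolding strongly_measurable_def by blast
  have "AE x in M. (\<lambda>i. s i x) \<longlonglongrightarrow> g x"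
    using s(2) assms(1) by eventually_elim simp
  with s(1) show ?thesis
    unfolding strongly_measurable_def by blast
qed

text \<open>A continuous \<open>F\<close> carries a.e. limits of simple functions to a.e. limits of
  simple functions. Arguing on the approximants avoids the product sigma-algebra, which is badly
  behaved without separability.\<close>

lemma strongly_measurable_compose2:
  assumes f: "strongly_measurable M f" and g: "strongly_measurable M g"
    and F: "\<And>x y. isCont (\<lambda>p. F (fst p) (snd p)) (x, y)"
  shows "strongly_measurable M (\<lambda>x. F (f x) (g x))"
proof -
  obtain s where s: "\<And>i::nat. simple_function M (s i)" "AE x in M. (\<lambda>i. s i x) \<longlonglongrightarrow> f x"
    using f unfolding strongly_measurable_def by blast
  obtain s' where s': "\<And>i::nat. simple_function M (s' i)" "AE x in M. (\<lambda>i. s' i x) \<longlonglongrightarrow> g x"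
    using g unfolding strongly_measurable_def by blast
  have "AE x in M. (\<lambda>i. F (s i x) (s' i x)) \<longlonglongrightarrow> F (f x) (g x)"
    using s(2) s'(2)
  proof eventually_elim
    case (elim x)
    show ?case
      using isCont_tendsto_compose[OF F tendsto_Pair[OF elim]] by simp
  qed
  moreover have "simple_function M (\<lambda>x. F (s i x) (s' i x))" for i
    by (rule simple_function_compose2[OF s(1) s'(1)])
  ultimately show ?thesis
    unfolding strongly_measurable_def by (intro exI[of _ "\<lambda>i x. F (s i x) (s' i x)"]) auto
qed

lemma strongly_measurable_diff:
  "strongly_measurable M f \<Longrightarrow> strongly_measurable M g \<Longrightarrow> strongly_measurable M (\<lambda>x. f x - g x)"
  by (rule strongly_measurable_compose2[where F = "(-)"]) (auto intro!: continuous_intros)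

lemma strongly_measurable_add:
  "strongly_measurable M f \<Longrightarrow> strongly_measurable M g \<Longrightarrow> strongly_measurable M (\<lambda>x. f x + g x)"
  by (rule strongly_measurable_compose2[where F = "(+)"]) (auto intro!: continuous_intros)

lemma strongly_measurable_scaleR:
  "strongly_measurable M f \<Longrightarrow> strongly_measurable M g \<Longrightarrow> strongly_measurable M (\<lambda>x. f x *\<^sub>R g x)"
  by (rule strongly_measurable_compose2[where F = "(*\<^sub>R)"]) (auto intro!: continuous_intros)

text \<open>Monotonicity handles \<open>k\<close>; additivity is applied to the Borel
  representatives of the two norms on the right.\<close>

lemma nn_integral_norm_triangle:
  assumes f: "strongly_measurable M f" and g: "strongly_measurable M g"
    and le: "AE x in M. norm (k x) \<le> norm (f x) + norm (g x)"
  shows "(\<integral>\<^sup>+x. ennreal (norm (k x)) \<partial>M)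
    \<le> (\<integral>\<^sup>+x. ennreal (norm (f x)) \<partial>M) + (\<integral>\<^sup>+x. ennreal (norm (g x)) \<partial>M)"
proof -
  obtain f' where f': "f' \<in> borel_measurable M" "AE x in M. norm (f x) = f' x" "\<And>x. 0 \<le> f' x"
    using strongly_measurable_norm_AE[OF f, of thesis] by blast
  obtain g' where g': "g' \<in> borel_measurable M" "AE x in M. norm (g x) = g' x" "\<And>x. 0 \<le> g' x"
    using strongly_measurable_norm_AE[OF g, of thesis] by blast
  have "AE x in M. ennreal (norm (k x)) \<le> ennreal (f' x) + ennreal (g' x)"
    using le f'(2) g'(2)
    by eventually_elim (simp add: f'(3) g'(3) flip: ennreal_plus)
  then have "(\<integral>\<^sup>+x. ennreal (norm (k x)) \<partial>M) \<le> (\<integral>\<^sup>+x. ennreal (f' x) + ennreal (g' x) \<partial>M)"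
    by (rule nn_integral_mono_AE)
  also have "\<dots> = (\<integral>\<^sup>+x. ennreal (f' x) \<partial>M) + (\<integral>\<^sup>+x. ennreal (g' x) \<partial>M)"
    using f'(1) g'(1) by (intro nn_integral_add) auto
  also have "(\<integral>\<^sup>+x. ennreal (f' x) \<partial>M) = (\<integral>\<^sup>+x. ennreal (norm (f x)) \<partial>M)"
    using f'(2) by (intro nn_integral_cong_AE) auto
  also have "(\<integral>\<^sup>+x. ennreal (g' x) \<partial>M) = (\<integral>\<^sup>+x. ennreal (norm (g x)) \<partial>M)"
    using g'(2) by (intro nn_integral_cong_AE) auto
  finally show ?thesis .
qed

section \<open>The integral as an L1 limit of simple integrals: norm bound, uniqueness,
  existence\<close>

lemma has_bintI:
  assumes "strongly_measurable M f"
    and "\<And>i::nat. Bochner_Integration.simple_bochner_integrable M (s i)"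
    and "(\<lambda>i. \<integral>\<^sup>+x. ennreal (norm (f x - s i x)) \<partial>M) \<longlonglongrightarrow> 0"
    and "(\<lambda>i. Bochner_Integration.simple_bochner_integral M (s i)) \<longlonglongrightarrow> v"
  shows "has_bint M f v"
  unfolding has_bint_def using assms by blast

lemma has_bintE:
  assumes "has_bint M f v"
  obtains s where "strongly_measurable M f"
    and "\<And>i::nat. Bochner_Integration.simple_bochner_integrable M (s i)"
    and "\<And>i. strongly_measurable M (s i)"
    and "(\<lambda>i. \<integral>\<^sup>+x. ennreal (norm (f x - s i x)) \<partial>M) \<longlonglongrightarrow> 0"
    and "(\<lambda>i. Bochner_Integration.simple_bochner_integral M (s i)) \<longlonglongrightarrow> v"
proof -
  obtain s where s: "\<And>i::nat. Bochner_Integration.simple_bochner_integrable M (s i)"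
      "(\<lambda>i. \<integral>\<^sup>+x. ennreal (norm (f x - s i x)) \<partial>M) \<longlonglongrightarrow> 0"
      "(\<lambda>i. Bochner_Integration.simple_bochner_integral M (s i)) \<longlonglongrightarrow> v"
    and f: "strongly_measurable M f"
    using assms unfolding has_bint_def by blast
  have "strongly_measurable M (s i)" for i
    using s(1)[of i] by cases (rule strongly_measurable_simple_function)
  with f s show thesis using that by blast
qed

lemma has_bint_cong_AE:
  assumes eq: "AE x in M. f x = g x" and f: "has_bint M f v"
  shows "has_bint M g v"
  using f
proof (rule has_bintE)
  fix s assume f: "strongly_measurable M f"
    and s: "\<And>i::nat. Bochner_Integration.simple_bochner_integrable M (s i)"
      "(\<lambda>i. \<integral>\<^sup>+x. ennreal (norm (f x - s i x)) \<partial>M) \<longlonglongrightarrow> 0"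
      "(\<lambda>i. Bochner_Integration.simple_bochner_integral M (s i)) \<longlonglongrightarrow> v"
  have "(\<integral>\<^sup>+x. ennreal (norm (f x - s i x)) \<partial>M) = (\<integral>\<^sup>+x. ennreal (norm (g x - s i x)) \<partial>M)" for i
    using eq by (intro nn_integral_cong_AE) auto
  with s(2) have "(\<lambda>i. \<integral>\<^sup>+x. ennreal (norm (g x - s i x)) \<partial>M) \<longlonglongrightarrow> 0"
    by simp
  from has_bintI[OF strongly_measurable_cong_AE[OF eq f] s(1) this s(3)]
  show ?thesis .
qed

lemma has_bint_diff:
  assumes f: "has_bint M f v" and g: "has_bint M g w"
  shows "has_bint M (\<lambda>x. f x - g x) (v - w)"
proof -
  obtain s where fm: "strongly_measurable M f"
    and s: "\<And>i::nat. Bochner_Integration.simple_bochner_integrable M (s i)"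
      "\<And>i. strongly_measurable M (s i)"
      "(\<lambda>i. \<integral>\<^sup>+x. ennreal (norm (f x - s i x)) \<partial>M) \<longlonglongrightarrow> 0"
      "(\<lambda>i. Bochner_Integration.simple_bochner_integral M (s i)) \<longlonglongrightarrow> v"
    using has_bintE[OF f, of thesis] by blast
  obtain s' where gm: "strongly_measurable M g"
    and s': "\<And>i::nat. Bochner_Integration.simple_bochner_integrable M (s' i)"
      "\<And>i. strongly_measurable M (s' i)"
      "(\<lambda>i. \<integral>\<^sup>+x. ennreal (norm (g x - s' i x)) \<partial>M) \<longlonglongrightarrow> 0"
      "(\<lambda>i. Bochner_Integration.simple_bochner_integral M (s' i)) \<longlonglongrightarrow> w"
    using has_bintE[OF g, of thesis] by blast
  have lim: "(\<lambda>i. \<integral>\<^sup>+x. ennreal (norm ((f x - g x) - (s i x - s' i x))) \<partial>M) \<longlonglongrightarrow> 0"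
  proof (rule tendsto_sandwich[OF _ _ tendsto_const])
    show "\<forall>\<^sub>F i in sequentially. (\<integral>\<^sup>+x. ennreal (norm ((f x - g x) - (s i x - s' i x))) \<partial>M)
      \<le> (\<integral>\<^sup>+x. ennreal (norm (f x - s i x)) \<partial>M) + (\<integral>\<^sup>+x. ennreal (norm (g x - s' i x)) \<partial>M)"
    proof (intro always_eventually allI nn_integral_norm_triangle AE_I2)
      show "norm ((f x - g x) - (s i x - s' i x)) \<le> norm (f x - s i x) + norm (g x - s' i x)" for i x
        using norm_triangle_ineq4[of "f x - s i x" "g x - s' i x"] by (simp add: algebra_simps)
    qed (intro strongly_measurable_diff fm gm s s')+
    show "(\<lambda>i. (\<integral>\<^sup>+x. ennreal (norm (f x - s i x)) \<partial>M) + (\<integral>\<^sup>+x. ennreal (norm (g x - s' i x)) \<partial>M)) \<longlonglongrightarrow> 0"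
      using tendsto_add[OF s(3) s'(3)] by simp
  qed simp
  have "(\<lambda>i. Bochner_Integration.simple_bochner_integral M (\<lambda>x. s i x - s' i x)) \<longlonglongrightarrow> v - w"
    using tendsto_diff[OF s(4) s'(4)] simple_bochner_integral_diff[OF s(1) s'(1)] by simp
  moreover have "Bochner_Integration.simple_bochner_integrable M (\<lambda>x. s i x - s' i x)" for i
    by (rule simple_bochner_integrable_compose2[where p = "(-)"]) (simp_all add: s s')
  ultimately show ?thesis
    by (intro has_bintI[OF strongly_measurable_diff[OF fm gm] _ lim])
qed

lemma simple_bochner_norm_le:
  assumes "Bochner_Integration.simple_bochner_integrable M s"
  shows "ennreal (norm (Bochner_Integration.simple_bochner_integral M s)) \<le> (\<integral>\<^sup>+x. ennreal (norm (s x)) \<partial>M)"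
    and "(\<integral>\<^sup>+x. ennreal (norm (s x)) \<partial>M) < \<infinity>"
proof -
  have n: "Bochner_Integration.simple_bochner_integrable M (\<lambda>x. norm (s x))"
    using simple_bochner_integrable_compose2[of "\<lambda>x y. norm x" M s s] assms by simp
  have e: "ennreal (Bochner_Integration.simple_bochner_integral M (\<lambda>x. norm (s x)))
      = (\<integral>\<^sup>+x. ennreal (norm (s x)) \<partial>M)"
    by (rule simple_bochner_integral_eq_nn_integral[OF n]) simp
  show "ennreal (norm (Bochner_Integration.simple_bochner_integral M s)) \<le> (\<integral>\<^sup>+x. ennreal (norm (s x)) \<partial>M)"
    unfolding e[symmetric] by (intro ennreal_leI simple_bochner_integral_norm_bound assms)
  show "(\<integral>\<^sup>+x. ennreal (norm (s x)) \<partial>M) < \<infinity>"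
    unfolding e[symmetric] by simp
qed

text \<open>The bound passes from the approximants to the limit because \<open>norm (s i x)\<close>
  is at most \<open>norm (f x) + norm (f x - s i x)\<close> and the second integral tends to 0.
  Applied to \<open>f - f\<close> it gives uniqueness of the integral, and all later estimates start
  from it.\<close>

lemma has_bint_norm_le:
  assumes f: "has_bint M f v"
  shows "ennreal (norm v) \<le> (\<integral>\<^sup>+x. ennreal (norm (f x)) \<partial>M)"
proof -
  obtain s where fm: "strongly_measurable M f"
    and s1: "\<And>i::nat. Bochner_Integration.simple_bochner_integrable M (s i)"
    and sm: "\<And>i. strongly_measurable M (s i)"
    and s: "(\<lambda>i. \<integral>\<^sup>+x. ennreal (norm (f x - s i x)) \<partial>M) \<longlonglongrightarrow> 0"
      "(\<lambda>i. Bochner_Integration.simple_bochner_integral M (s i)) \<longlonglongrightarrow> v"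
    using has_bintE[OF f, of thesis] by blast
  have le: "ennreal (norm (Bochner_Integration.simple_bochner_integral M (s i)))
      \<le> (\<integral>\<^sup>+x. ennreal (norm (f x)) \<partial>M) + (\<integral>\<^sup>+x. ennreal (norm (f x - s i x)) \<partial>M)" for i
  proof (rule order.trans[OF simple_bochner_norm_le(1)[OF s1]])
    have "norm (s i x) \<le> norm (f x) + norm (f x - s i x)" for x
      using norm_triangle_ineq4[of "f x" "f x - s i x"] by simp
    then show "(\<integral>\<^sup>+x. ennreal (norm (s i x)) \<partial>M)
      \<le> (\<integral>\<^sup>+x. ennreal (norm (f x)) \<partial>M) + (\<integral>\<^sup>+x. ennreal (norm (f x - s i x)) \<partial>M)"
      by (intro nn_integral_norm_triangle strongly_measurable_diff fm sm) auto
  qed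
  have "(\<lambda>i. ennreal (norm (Bochner_Integration.simple_bochner_integral M (s i)))) \<longlonglongrightarrow> ennreal (norm v)"
    by (intro tendsto_ennrealI tendsto_norm s)
  moreover have "(\<lambda>i. (\<integral>\<^sup>+x. ennreal (norm (f x)) \<partial>M) + (\<integral>\<^sup>+x. ennreal (norm (f x - s i x)) \<partial>M))
      \<longlonglongrightarrow> (\<integral>\<^sup>+x. ennreal (norm (f x)) \<partial>M) + 0"
    by (intro tendsto_add tendsto_const s)
  ultimately have "ennreal (norm v) \<le> (\<integral>\<^sup>+x. ennreal (norm (f x)) \<partial>M) + 0"
    by (rule LIMSEQ_le) (use le in blast)
  then show ?thesis
    by simp
qed

lemma has_bint_unique:
  assumes "has_bint M f v" "has_bint M f w"
  shows "v = w"
  using has_bint_norm_le[OF has_bint_diff[OF assms]] by simp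

lemma has_bint_norm_finite:
  assumes f: "has_bint M f v"
  shows "(\<integral>\<^sup>+x. ennreal (norm (f x)) \<partial>M) < \<infinity>"
proof -
  obtain s where fm: "strongly_measurable M f"
    and s1: "\<And>i::nat. Bochner_Integration.simple_bochner_integrable M (s i)"
    and sm: "\<And>i. strongly_measurable M (s i)"
    and s: "(\<lambda>i. \<integral>\<^sup>+x. ennreal (norm (f x - s i x)) \<partial>M) \<longlonglongrightarrow> 0"
      "(\<lambda>i. Bochner_Integration.simple_bochner_integral M (s i)) \<longlonglongrightarrow> v"
    using has_bintE[OF f, of thesis] by blast
  \<comment> \<open>A single approximant at finite L1 distance is enough, since it has finite L1
    norm itself.\<close>
  have "\<forall>\<^sub>F i in sequentially. (\<integral>\<^sup>+x. ennreal (norm (f x - s i x)) \<partial>M) < \<infinity>"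
    by (rule order_tendstoD(2)[OF s(1)]) simp
  then obtain i where i: "(\<integral>\<^sup>+x. ennreal (norm (f x - s i x)) \<partial>M) < \<infinity>"
    by (auto simp: eventually_sequentially)
  have "norm (f x) \<le> norm (s i x) + norm (f x - s i x)" for x
    using norm_triangle_ineq[of "s i x" "f x - s i x"] by simp
  then have "(\<integral>\<^sup>+x. ennreal (norm (f x)) \<partial>M)
      \<le> (\<integral>\<^sup>+x. ennreal (norm (s i x)) \<partial>M) + (\<integral>\<^sup>+x. ennreal (norm (f x - s i x)) \<partial>M)"
    by (intro nn_integral_norm_triangle strongly_measurable_diff fm sm) auto
  also have "\<dots> < \<infinity>"
    using i simple_bochner_norm_le(2)[OF s1] by (simp add: ennreal_add_less_top)
  finally show ?thesis .
qed

text \<open>Bochner's criterion. The approximants are truncated so that they are dominated by a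
  multiple of the norm of the limit; dominated convergence then gives L1 convergence, and
  completeness of the space gives a limit of their integrals.\<close>

lemma has_bint_exists:
  fixes f :: "'b \<Rightarrow> 'a::banach"
  assumes f: "strongly_measurable M f" and fin: "(\<integral>\<^sup>+x. ennreal (norm (f x)) \<partial>M) < \<infinity>"
  shows "\<exists>v. has_bint M f v"
proof -
  obtain f' s where s: "\<And>i::nat. simple_function M (s i)"
    "\<And>x. x \<in> space M \<Longrightarrow> (\<lambda>i. s i x) \<longlonglongrightarrow> f' x" "AE x in M. f x = f' x"
    using strongly_measurable_everywhere[OF f, of thesis] by blast
  have ns: "(\<lambda>x. norm (s i x)) \<in> borel_measurable M" for i
    by (rule borel_measurable_simple_function[OF simple_function_compose1[OF s(1)]])
  have nf: "(\<lambda>x. norm (f' x)) \<in> borel_measurable M"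
  proof (rule borel_measurable_LIMSEQ_metric[OF ns])
    show "(\<lambda>i. norm (s i x)) \<longlonglongrightarrow> norm (f' x)" if "x \<in> space M" for x
      by (intro tendsto_norm s(2) that)
  qed
  have fin': "(\<integral>\<^sup>+x. ennreal (norm (f' x)) \<partial>M) < \<infinity>"
  proof -
    have "(\<integral>\<^sup>+x. ennreal (norm (f' x)) \<partial>M) = (\<integral>\<^sup>+x. ennreal (norm (f x)) \<partial>M)"
      using s(3) by (intro nn_integral_cong_AE) auto
    then show ?thesis using fin by simp
  qed
  \<comment> \<open>A factor larger than 1 makes the truncation eventually inactive wherever
    \<open>f' x\<close> is nonzero; where \<open>f' x = 0\<close> the truncated value is always
    0.\<close>
  define r where "r i x = (if norm (s i x) \<le> 2 * norm (f' x) then s i x else 0)" for i x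
  have r_le: "norm (r i x) \<le> 2 * norm (f' x)" for i x
    by (simp add: r_def)
  have r_simple: "simple_function M (r i)" for i
    unfolding r_def using s(1) nf ns[of i] by (intro simple_function_If) auto
  have r_lim: "(\<lambda>i. r i x) \<longlonglongrightarrow> f' x" if x: "x \<in> space M" for x
  proof (cases "f' x = 0")
    case True
    then have "r i x = 0" for i by (auto simp: r_def)
    then show ?thesis using True by simp
  next
    case False
    then have "norm (f' x) < 2 * norm (f' x)" by simp
    then have "\<forall>\<^sub>F i in sequentially. norm (s i x) < 2 * norm (f' x)"
      by (rule order_tendstoD(2)[OF tendsto_norm[OF s(2)[OF x]]])
    then have "\<forall>\<^sub>F i in sequentially. s i x = r i x"
      by eventually_elim (auto simp: r_def)
    then show ?thesis
      by (rule Lim_transform_eventually[OF s(2)[OF x]])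
  qed
  have r_int: "Bochner_Integration.simple_bochner_integrable M (r i)" for i
  proof (rule simple_bochner_integrableI_bounded[OF r_simple])
    have "(\<integral>\<^sup>+x. ennreal (norm (r i x)) \<partial>M) \<le> (\<integral>\<^sup>+x. 2 * ennreal (norm (f' x)) \<partial>M)"
    proof (intro nn_integral_mono)
      show "ennreal (norm (r i x)) \<le> 2 * ennreal (norm (f' x))" for x
        using ennreal_leI[OF r_le[of i x]] by (simp add: ennreal_mult')
    qed
    also have "\<dots> = 2 * (\<integral>\<^sup>+x. ennreal (norm (f' x)) \<partial>M)"
      using nf by (intro nn_integral_cmult) auto
    also have "\<dots> < \<infinity>"
      using fin' by (simp add: ennreal_mult_less_top)
    finally show "(\<integral>\<^sup>+x. ennreal (norm (r i x)) \<partial>M) < \<infinity>" .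
  qed
  have d_meas: "(\<lambda>x. norm (f' x - r i x)) \<in> borel_measurable M" for i
  proof (rule borel_measurable_LIMSEQ_metric)
    show "(\<lambda>x. norm (s k x - r i x)) \<in> borel_measurable M" for k
      by (rule borel_measurable_simple_function[OF simple_function_compose2[OF s(1) r_simple]])
    show "(\<lambda>k. norm (s k x - r i x)) \<longlonglongrightarrow> norm (f' x - r i x)" if "x \<in> space M" for x
      by (intro tendsto_intros s(2) that)
  qed
  have lim: "(\<lambda>i. \<integral>\<^sup>+x. ennreal (norm (f' x - r i x)) \<partial>M) \<longlonglongrightarrow> (\<integral>\<^sup>+x. 0 \<partial>M)"
  \<comment> \<open>The 3 is 1 for \<open>f'\<close> plus 2 for the truncated approximant.\<close>
  proof (rule nn_integral_dominated_convergence[where w = "\<lambda>x. 3 * ennreal (norm (f' x))"])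
    show "AE x in M. ennreal (norm (f' x - r j x)) \<le> 3 * ennreal (norm (f' x))" for j
    proof (intro AE_I2)
      fix x
      have "norm (f' x - r j x) \<le> 3 * norm (f' x)"
        using norm_triangle_ineq4[of "f' x" "r j x"] r_le[of j x] by simp
      from ennreal_leI[OF this] show "ennreal (norm (f' x - r j x)) \<le> 3 * ennreal (norm (f' x))"
        by (simp add: ennreal_mult')
    qed
    show "(\<integral>\<^sup>+x. 3 * ennreal (norm (f' x)) \<partial>M) < \<infinity>"
      using nf fin' by (subst nn_integral_cmult) (auto simp: ennreal_mult_less_top)
    show "AE x in M. (\<lambda>i. ennreal (norm (f' x - r i x))) \<longlonglongrightarrow> 0"
    proof (intro AE_I2)
      fix x assume "x \<in> space M"
      then have "(\<lambda>i. norm (f' x - r i x)) \<longlonglongrightarrow> norm (f' x - f' x)"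
        by (intro tendsto_intros r_lim)
      then have "(\<lambda>i. norm (f' x - r i x)) \<longlonglongrightarrow> 0" by simp
      then show "(\<lambda>i. ennreal (norm (f' x - r i x))) \<longlonglongrightarrow> 0"
        using tendsto_ennrealI by force
    qed
  qed (use nf d_meas in auto)
  have sm: "strongly_measurable M (r i)" for i
    by (rule strongly_measurable_simple_function[OF r_simple])
  have fm': "strongly_measurable M f'"
    by (rule strongly_measurable_cong_AE[OF s(3) f])
  let ?I = "\<lambda>i. Bochner_Integration.simple_bochner_integral M (r i)"
  let ?d = "\<lambda>i. \<integral>\<^sup>+x. ennreal (norm (f' x - r i x)) \<partial>M"
  have I_le: "ennreal (norm (?I i - ?I k)) \<le> ?d i + ?d k" for i k
  proof -
    have "ennreal (norm (?I i - ?I k))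
        = ennreal (norm (Bochner_Integration.simple_bochner_integral M (\<lambda>x. r i x - r k x)))"
      by (simp add: simple_bochner_integral_diff[OF r_int r_int])
    also have "\<dots> \<le> (\<integral>\<^sup>+x. ennreal (norm (r i x - r k x)) \<partial>M)"
      by (rule simple_bochner_norm_le(1)[OF simple_bochner_integrable_compose2[where p = "(-)"]])
        (simp_all add: r_int)
    also have "\<dots> \<le> ?d i + ?d k"
    proof (intro nn_integral_norm_triangle strongly_measurable_diff fm' sm AE_I2)
      show "norm (r i x - r k x) \<le> norm (f' x - r i x) + norm (f' x - r k x)" for x
        using norm_triangle_ineq4[of "f' x - r k x" "f' x - r i x"] by (simp add: algebra_simps)
    qed
    finally show ?thesis .
  qed
  have "Cauchy ?I"
  proof (rule metric_CauchyI)
    fix e :: real assume e: "0 < e"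
    have "\<forall>\<^sub>F i in sequentially. ?d i < ennreal (e / 2)"
      by (rule order_tendstoD(2)[OF lim]) (use e in auto)
    then obtain K where K: "\<And>i. i \<ge> K \<Longrightarrow> ?d i < ennreal (e / 2)"
      by (auto simp: eventually_sequentially)
    show "\<exists>K. \<forall>i\<ge>K. \<forall>k\<ge>K. dist (?I i) (?I k) < e"
    proof (intro exI[of _ K] allI impI)
      fix i k assume "K \<le> i" "K \<le> k"
      then have "ennreal (norm (?I i - ?I k)) < ennreal (e / 2) + ennreal (e / 2)"
        using I_le[of i k] add_strict_mono[OF K K] by (meson le_less_trans)
      also have "\<dots> = ennreal e"
        using e by (simp flip: ennreal_plus)
      finally show "dist (?I i) (?I k) < e"
        using e by (simp add: dist_norm ennreal_less_iff)
    qed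
  qed
  then obtain v where "?I \<longlonglongrightarrow> v"
    using Cauchy_convergent convergent_def by blast
  then have "has_bint M f' v"
    using has_bintI[OF fm' r_int] lim by simp
  moreover have "AE x in M. f' x = f x" using s(3) by auto
  ultimately show ?thesis
    using has_bint_cong_AE by blast
qed

lemma has_bint_restrict_space:
  fixes f :: "'b \<Rightarrow> 'a::real_normed_vector"
  assumes \<Omega>: "\<Omega> \<inter> space M \<in> sets M" and f: "has_bint (restrict_space M \<Omega>) f v"
  shows "has_bint M (\<lambda>x. indicator \<Omega> x *\<^sub>R f x) v"
proof -
  let ?N = "restrict_space M \<Omega>"
  obtain s where s: "\<And>i::nat. Bochner_Integration.simple_bochner_integrable ?N (s i)"
      "(\<lambda>i. \<integral>\<^sup>+x. ennreal (norm (f x - s i x)) \<partial>?N) \<longlonglongrightarrow> 0"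
      "(\<lambda>i. Bochner_Integration.simple_bochner_integral ?N (s i)) \<longlonglongrightarrow> v"
    using f unfolding has_bint_def by blast
  obtain r where r: "\<And>i::nat. simple_function ?N (r i)" "AE x in ?N. (\<lambda>i. r i x) \<longlonglongrightarrow> f x"
    using f unfolding has_bint_def strongly_measurable_def by blast
  have "strongly_measurable M (\<lambda>x. indicator \<Omega> x *\<^sub>R f x)"
    unfolding strongly_measurable_def
  proof (intro exI[of _ "\<lambda>i x. indicator \<Omega> x *\<^sub>R r i x"] conjI allI)
    show "simple_function M (\<lambda>x. indicator \<Omega> x *\<^sub>R r i x)" for i
      using r(1) simple_function_restrict_space[OF \<Omega>] by blast
    have "AE x in M. x \<in> \<Omega> \<longrightarrow> (\<lambda>i. r i x) \<longlonglongrightarrow> f x"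
      using r(2) by (simp add: AE_restrict_space_iff[OF \<Omega>])
    then show "AE x in M. (\<lambda>i. indicator \<Omega> x *\<^sub>R r i x) \<longlonglongrightarrow> indicator \<Omega> x *\<^sub>R f x"
      by eventually_elim (auto simp: indicator_def)
  qed
  moreover have "(\<integral>\<^sup>+x. ennreal (norm (f x - s i x)) \<partial>?N)
      = (\<integral>\<^sup>+x. ennreal (norm (indicator \<Omega> x *\<^sub>R f x - indicator \<Omega> x *\<^sub>R s i x)) \<partial>M)" for i
    unfolding nn_integral_restrict_space[OF \<Omega>]
    by (intro nn_integral_cong) (auto simp: indicator_def)
  moreover have "Bochner_Integration.simple_bochner_integrable M (\<lambda>x. indicator \<Omega> x *\<^sub>R s i x)" for i
    using s(1) simple_bochner_integrable_restrict_space[OF \<Omega>] by blast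
  ultimately show ?thesis
    using s(2,3) simple_bochner_integral_restrict_space[OF \<Omega> s(1)]
    by (intro has_bintI[where s = "\<lambda>i x. indicator \<Omega> x *\<^sub>R s i x"]) simp_all
qed

section \<open>Stability of strong measurability: restriction, limits, superposition\<close>

lemma strongly_measurable_restrict_space:
  assumes "strongly_measurable M f" "\<Omega> \<in> sets M"
  shows "strongly_measurable (restrict_space M \<Omega>) f"
proof -
  obtain s where s: "\<And>i::nat. simple_function M (s i)" "AE x in M. (\<lambda>i. s i x) \<longlonglongrightarrow> f x"
    using assms unfolding strongly_measurable_def by blast
  have \<Omega>: "\<Omega> \<subseteq> space M"
    using assms(2) by (rule sets.sets_into_space)
  have "simple_function (restrict_space M \<Omega>) (s i)" for i
    unfolding simple_function_def space_restrict_space2[OF assms(2)]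
  proof (intro conjI ballI)
    show "finite (s i ` \<Omega>)"
      using simple_functionD(1)[OF s(1)[of i]] \<Omega> by (meson finite_subset image_mono)
    fix y
    have "s i -` {y} \<inter> \<Omega> = \<Omega> \<inter> (s i -` {y} \<inter> space M)"
      using \<Omega> by auto
    then show "s i -` {y} \<inter> \<Omega> \<in> sets (restrict_space M \<Omega>)"
      using simple_functionD(2)[OF s(1)] unfolding sets_restrict_space by blast
  qed
  moreover have "AE x in restrict_space M \<Omega>. (\<lambda>i. s i x) \<longlonglongrightarrow> f x"
    using s(2) assms(2) by (subst AE_restrict_space_iff) auto
  ultimately show ?thesis
    unfolding strongly_measurable_def by blast
qed

text \<open>Each \<open>g n\<close> is replaced by a simple function so close to it in measure that
  the errors are summable almost everywhere, hence tend to 0 there. The simple functions then have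
  the same a.e. limit as \<open>g n\<close>.\<close>

lemma strongly_measurable_limit:
  fixes f :: "'b \<Rightarrow> 'a::real_normed_vector"
  assumes fin: "emeasure M (space M) < \<infinity>"
    and g: "\<And>n::nat. strongly_measurable M (g n)"
    and lim: "AE x in M. (\<lambda>n. g n x) \<longlonglongrightarrow> f x"
  shows "strongly_measurable M f"
proof -
  \<comment> \<open>The Borel function \<open>d\<close>, standing for the truncated error, is
    selected together with the simple function \<open>r\<close>, so that one application of choice
    supplies both sequences.\<close>
  define Q where "Q n r d \<longleftrightarrow> simple_function M r \<and> d \<in> borel_measurable M
      \<and> (\<integral>\<^sup>+x. ennreal (d x) \<partial>M) < ennreal ((1/2)^n)
      \<and> (AE x in M. d x = min 1 (norm (g n x - r x)))" for n r d
  have "\<exists>p. Q n (fst p) (snd p)" for n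
  proof -
    obtain g' s where s: "\<And>i::nat. simple_function M (s i)"
      "\<And>x. x \<in> space M \<Longrightarrow> (\<lambda>i. s i x) \<longlonglongrightarrow> g' x" "AE x in M. g n x = g' x"
      using strongly_measurable_everywhere[OF g, of n thesis] by blast
    \<comment> \<open>The cap at 1 provides an integrable majorant on a space of finite measure even
      though \<open>g n\<close> need not be integrable.\<close>
    define d where "d i x = min 1 (norm (g' x - s i x))" for i x
    have d_le: "d i x \<le> 1" for i x
      by (simp add: d_def)
    have d_meas: "d i \<in> borel_measurable M" for i
      unfolding d_def
    proof (rule borel_measurable_LIMSEQ_metric)
      show "(\<lambda>x. min 1 (norm (s k x - s i x))) \<in> borel_measurable M" for k
        by (rule borel_measurable_simple_function[OF simple_function_compose2[OF s(1) s(1)]])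
      show "(\<lambda>k. min 1 (norm (s k x - s i x))) \<longlonglongrightarrow> min 1 (norm (g' x - s i x))" if "x \<in> space M" for x
        by (intro tendsto_intros s(2) that)
    qed
    have "(\<lambda>i. \<integral>\<^sup>+x. ennreal (d i x) \<partial>M) \<longlonglongrightarrow> (\<integral>\<^sup>+x. 0 \<partial>M)"
    proof (rule nn_integral_dominated_convergence[where w = "\<lambda>x. 1"])
      show "AE x in M. (\<lambda>i. ennreal (d i x)) \<longlonglongrightarrow> 0"
      proof (intro AE_I2)
        fix x assume "x \<in> space M"
        then have "(\<lambda>i. d i x) \<longlonglongrightarrow> min 1 (norm (g' x - g' x))"
          unfolding d_def by (intro tendsto_intros s(2))
        then have "(\<lambda>i. d i x) \<longlonglongrightarrow> 0" by simp
        then show "(\<lambda>i. ennreal (d i x)) \<longlonglongrightarrow> 0"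
          using tendsto_ennrealI by force
      qed
    qed (use fin d_meas d_le in auto)
    then have "\<forall>\<^sub>F i in sequentially. (\<integral>\<^sup>+x. ennreal (d i x) \<partial>M) < ennreal ((1/2)^n)"
      by (rule order_tendstoD(2)) auto
    then obtain i where "(\<integral>\<^sup>+x. ennreal (d i x) \<partial>M) < ennreal ((1/2)^n)"
      by (auto simp: eventually_sequentially)
    moreover have "AE x in M. d i x = min 1 (norm (g n x - s i x))"
      using s(3) by eventually_elim (simp add: d_def)
    ultimately have "Q n (s i) (d i)"
      using s(1) d_meas unfolding Q_def by blast
    then show ?thesis
      by (intro exI[of _ "(s i, d i)"]) simp
  qed
  then have "\<exists>p. \<forall>n. Q n (fst (p n)) (snd (p n))"
    by (intro choice allI)
  then obtain p where p: "\<And>n. Q n (fst (p n)) (snd (p n))"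
    by blast
  define r d where "r n = fst (p n)" and "d n = snd (p n)" for n
  have r: "simple_function M (r n)"
    and d: "d n \<in> borel_measurable M" "(\<integral>\<^sup>+x. ennreal (d n x) \<partial>M) < ennreal ((1/2)^n)"
      "AE x in M. d n x = min 1 (norm (g n x - r n x))" for n
    using p[of n] unfolding Q_def r_def d_def by blast+
  \<comment> \<open>Borel-Cantelli in integral form: the integrals sum to at most a convergent
    geometric series, so the pointwise series is finite almost everywhere.\<close>
  have "(\<integral>\<^sup>+x. (\<Sum>n. ennreal (d n x)) \<partial>M) = (\<Sum>n. \<integral>\<^sup>+x. ennreal (d n x) \<partial>M)"
    using d(1) by (intro nn_integral_suminf) auto
  also have "\<dots> \<le> (\<Sum>n. ennreal ((1/2)^n))"
    using d(2) by (intro suminf_le) (auto intro: less_imp_le)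
  also have "\<dots> = ennreal (\<Sum>n. (1/2)^n)"
    by (intro suminf_ennreal2) (auto intro: summable_geometric)
  finally have "(\<integral>\<^sup>+x. (\<Sum>n. ennreal (d n x)) \<partial>M) \<noteq> \<infinity>"
    by (auto simp: top_unique)
  then have "AE x in M. (\<Sum>n. ennreal (d n x)) \<noteq> \<infinity>"
    using d(1) by (intro nn_integral_PInf_AE) auto
  moreover have "AE x in M. \<forall>n. d n x = min 1 (norm (g n x - r n x))"
    using d(3) by (simp add: AE_all_countable)
  ultimately have "AE x in M. (\<lambda>n. r n x) \<longlonglongrightarrow> f x"
    using lim
  proof eventually_elim
    case (elim x)
    have d0: "0 \<le> d n x" for n
      using elim(2) by simp
    have "summable (\<lambda>n. d n x)"
      using elim(1) d0 by (intro summable_suminf_not_top) auto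
    then have dlim: "(\<lambda>n. d n x) \<longlonglongrightarrow> 0"
      by (rule summable_LIMSEQ_zero)
    then have "\<forall>\<^sub>F n in sequentially. d n x < 1"
      by (rule order_tendstoD) simp
    then have "\<forall>\<^sub>F n in sequentially. d n x = norm (g n x - r n x)"
      by eventually_elim (use elim(2) in \<open>auto simp: min_def split: if_splits\<close>)
    then have "(\<lambda>n. norm (g n x - r n x)) \<longlonglongrightarrow> 0"
      using dlim by (rule Lim_transform_eventually[rotated])
    then have "(\<lambda>n. g n x - r n x) \<longlonglongrightarrow> 0"
      by (simp add: tendsto_norm_zero_iff)
    from tendsto_diff[OF elim(3) this] show ?case by simp
  qed
  with r show ?thesis
    unfolding strongly_measurable_def by blast
qed

text \<open>For a simple \<open>z\<close> the superposition is patched from finitely many slices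
  \<open>k x v\<close>; continuity of \<open>k x\<close> then handles the a.e. limit. It serves for
  the integrands \<open>S (s - r) (g r)\<close> and \<open>H r (z r)\<close>.\<close>

lemma strongly_measurable_caratheodory:
  fixes k :: "'b \<Rightarrow> 'c::real_normed_vector \<Rightarrow> 'a::real_normed_vector"
  assumes fin: "emeasure M (space M) < \<infinity>"
    and k: "\<And>v. strongly_measurable M (\<lambda>x. k x v)"
    and cont: "\<And>x. x \<in> space M \<Longrightarrow> continuous_on UNIV (k x)"
    and z: "strongly_measurable M z"
  shows "strongly_measurable M (\<lambda>x. k x (z x))"
proof -
  obtain s where s: "\<And>i::nat. simple_function M (s i)" "AE x in M. (\<lambda>i. s i x) \<longlonglongrightarrow> z x"
    using z unfolding strongly_measurable_def by blast
  show ?thesis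
  proof (rule strongly_measurable_limit[OF fin])
    have "AE x in M. x \<in> space M" by simp
    then show "AE x in M. (\<lambda>i. k x (s i x)) \<longlonglongrightarrow> k x (z x)"
      using s(2)
    proof eventually_elim
      case (elim x)
      from cont[OF elim(1)] have "isCont (k x) (z x)"
        by (simp add: continuous_on_eq_continuous_at)
      then show ?case
        by (rule isCont_tendsto_compose[OF _ elim(2)])
    qed
    fix i
    have "\<exists>r. (\<forall>n::nat. simple_function M (r n)) \<and> (AE x in M. (\<lambda>n. r n x) \<longlonglongrightarrow> k x v)" for v
      using k[of v] unfolding strongly_measurable_def .
    then obtain r where r: "\<And>v (n::nat). simple_function M (r v n)"
      "\<And>v. AE x in M. (\<lambda>n. r v n x) \<longlonglongrightarrow> k x v"
      by metis
    have fs: "finite (s i ` space M)"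
      using s(1) by (rule simple_functionD)
    have "simple_function M (\<lambda>x. r (s i x) n x)" for n
      unfolding simple_function_def
    proof (intro conjI ballI)
      show "finite ((\<lambda>x. r (s i x) n x) ` space M)"
        by (rule finite_subset[of _ "\<Union>v\<in>s i ` space M. r v n ` space M"])
          (use finite_UN_I[OF fs simple_functionD(1)[OF r(1)]] in auto)
      fix y
      have "(\<lambda>x. r (s i x) n x) -` {y} \<inter> space M
          = (\<Union>v\<in>s i ` space M. (s i -` {v} \<inter> space M) \<inter> (r v n -` {y} \<inter> space M))"
        by auto
      also have "\<dots> \<in> sets M"
        by (intro sets.finite_UN fs sets.Int simple_functionD(2)[OF s(1)] simple_functionD(2)[OF r(1)])
      finally show "(\<lambda>x. r (s i x) n x) -` {y} \<inter> space M \<in> sets M" .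
    qed
    \<comment> \<open>The null set depends on \<open>v\<close>; since \<open>s i\<close> takes
      finitely many values, the null sets can be united.\<close>
    moreover have "AE x in M. \<forall>v\<in>s i ` space M. (\<lambda>n. r v n x) \<longlonglongrightarrow> k x v"
      using fs r(2) by (intro AE_finite_allI) auto
    then have "AE x in M. (\<lambda>n. r (s i x) n x) \<longlonglongrightarrow> k x (s i x)"
      by (rule AE_mp) auto
    ultimately show "strongly_measurable M (\<lambda>x. k x (s i x))"
      unfolding strongly_measurable_def by (intro exI[of _ "\<lambda>n x. r (s i x) n x"]) auto
  qed
qed

section \<open>Integrals over real sets: comparison, extension, dominated convergence\<close>

lemma has_bint_bint_on:
  assumes "bintegrable_on S f"
  shows "has_bint (lebesgue_on S) f (bint_on S f)"
proof -
  obtain v where v: "has_bint (lebesgue_on S) f v"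
    using assms unfolding bintegrable_on_def by blast
  have "bint_on S f = (THE v. has_bint (lebesgue_on S) f v)"
    using v unfolding bint_on_def by auto
  then show ?thesis
    using theI[of "has_bint (lebesgue_on S) f", OF v] has_bint_unique v by metis
qed

lemma bint_on_eqI:
  assumes "has_bint (lebesgue_on S) f v"
  shows "bint_on S f = v"
  using has_bint_bint_on has_bint_unique assms unfolding bintegrable_on_def by blast

lemma bintegrable_on_iff:
  fixes f :: "real \<Rightarrow> 'a::banach"
  shows "bintegrable_on S f \<longleftrightarrow> strongly_measurable (lebesgue_on S) f
    \<and> (\<integral>\<^sup>+x. ennreal (norm (f x)) \<partial>lebesgue_on S) < \<infinity>"
  unfolding bintegrable_on_def
  using has_bint_exists has_bint_norm_finite has_bint_def by blast

lemma bintegrable_on_measurable: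
  "bintegrable_on S f \<Longrightarrow> strongly_measurable (lebesgue_on S) f"
  unfolding bintegrable_on_def has_bint_def by blast

lemma bintegrable_on_diff:
  "bintegrable_on S f \<Longrightarrow> bintegrable_on S g \<Longrightarrow> bintegrable_on S (\<lambda>x. f x - g x)"
  unfolding bintegrable_on_def using has_bint_diff by blast

lemma bint_on_diff:
  assumes "bintegrable_on S f" "bintegrable_on S g"
  shows "bint_on S (\<lambda>x. f x - g x) = bint_on S f - bint_on S g"
  by (intro bint_on_eqI has_bint_diff has_bint_bint_on assms)

lemma bintegrable_on_bound:
  fixes f :: "real \<Rightarrow> 'a::banach" and w :: "real \<Rightarrow> 'b::banach"
  assumes f: "strongly_measurable (lebesgue_on S) f" and w: "bintegrable_on S w"
    and le: "AE x in lebesgue_on S. norm (f x) \<le> norm (w x)"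
  shows "bintegrable_on S f"
proof -
  have "(\<integral>\<^sup>+x. ennreal (norm (f x)) \<partial>lebesgue_on S) \<le> (\<integral>\<^sup>+x. ennreal (norm (w x)) \<partial>lebesgue_on S)"
    using le by (intro nn_integral_mono_AE) (auto intro: ennreal_leI)
  then show ?thesis
    using f w unfolding bintegrable_on_iff by auto
qed

lemma bintegrable_on_add:
  fixes f g :: "real \<Rightarrow> 'a::banach"
  assumes f: "bintegrable_on S f" and g: "bintegrable_on S g"
  shows "bintegrable_on S (\<lambda>x. f x + g x)"
proof -
  have "(\<integral>\<^sup>+x. ennreal (norm (f x + g x)) \<partial>lebesgue_on S)
      \<le> (\<integral>\<^sup>+x. ennreal (norm (f x)) \<partial>lebesgue_on S) + (\<integral>\<^sup>+x. ennreal (norm (g x)) \<partial>lebesgue_on S)"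
    using f g by (intro nn_integral_norm_triangle)
      (auto simp: norm_triangle_ineq intro: bintegrable_on_measurable)
  also have "\<dots> < \<infinity>"
    using f g unfolding bintegrable_on_iff by (simp add: ennreal_add_less_top)
  finally show ?thesis
    using f g unfolding bintegrable_on_iff by (auto intro: strongly_measurable_add)
qed

lemma bintegrable_on_scaleR_const:
  fixes f :: "real \<Rightarrow> 'a::banach"
  assumes f: "bintegrable_on S f"
  shows "bintegrable_on S (\<lambda>x. c *\<^sub>R f x)"
proof -
  obtain g where g: "g \<in> borel_measurable (lebesgue_on S)" "AE x in lebesgue_on S. norm (f x) = g x"
    "\<And>x. 0 \<le> g x"
    using strongly_measurable_norm_AE[OF bintegrable_on_measurable[OF f], of thesis] by blast
  have "(\<integral>\<^sup>+x. ennreal (norm (c *\<^sub>R f x)) \<partial>lebesgue_on S) = (\<integral>\<^sup>+x. ennreal \<bar>c\<bar> * ennreal (g x) \<partial>lebesgue_on S)"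
    using g(2) by (intro nn_integral_cong_AE) (auto simp: ennreal_mult')
  also have "\<dots> = ennreal \<bar>c\<bar> * (\<integral>\<^sup>+x. ennreal (g x) \<partial>lebesgue_on S)"
    using g(1) by (intro nn_integral_cmult) auto
  also have "(\<integral>\<^sup>+x. ennreal (g x) \<partial>lebesgue_on S) = (\<integral>\<^sup>+x. ennreal (norm (f x)) \<partial>lebesgue_on S)"
    using g(2) by (intro nn_integral_cong_AE) auto
  finally show ?thesis
    using f strongly_measurable_scaleR[OF strongly_measurable_simple_function[OF simple_function_const], of "lebesgue_on S" f c]
    unfolding bintegrable_on_iff by (auto simp: ennreal_mult_less_top)
qed

lemma bintegrable_on_norm:
  fixes f :: "real \<Rightarrow> 'a::banach"
  assumes f: "bintegrable_on S f"
  shows "bintegrable_on S (\<lambda>x. norm (f x))"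
proof (rule bintegrable_on_bound[OF _ f])
  show "strongly_measurable (lebesgue_on S) (\<lambda>x. norm (f x))"
    by (rule strongly_measurable_compose2[where F = "\<lambda>x y. norm x", OF bintegrable_on_measurable bintegrable_on_measurable, OF f f])
      (intro continuous_intros)
qed simp

text \<open>A bridge to the gauge integral, through which closed forms for powers and exponentials
  become available as majorants.\<close>

lemma nn_integral_lebesgue_on_has_integral:
  fixes w :: "real \<Rightarrow> real"
  assumes "(w has_integral W) S" "\<And>x. x \<in> S \<Longrightarrow> 0 \<le> w x" "S \<in> sets lebesgue"
  shows "(\<integral>\<^sup>+x. ennreal (w x) \<partial>lebesgue_on S) = ennreal W"
  using nn_integral_has_integral_lebesgue'[OF assms(2,1)] assms(3)
  by (simp add: nn_integral_restrict_space nn_integral_completion)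

lemma bint_on_norm_le:
  fixes f :: "real \<Rightarrow> 'a::banach"
  assumes f: "bintegrable_on S f" and w: "(w has_integral W) S" "\<And>x. x \<in> S \<Longrightarrow> 0 \<le> w x"
    and S: "S \<in> sets lebesgue" and le: "AE x in lebesgue_on S. norm (f x) \<le> w x"
  shows "norm (bint_on S f) \<le> W"
proof -
  have "ennreal (norm (bint_on S f)) \<le> (\<integral>\<^sup>+x. ennreal (norm (f x)) \<partial>lebesgue_on S)"
    by (intro has_bint_norm_le has_bint_bint_on f)
  also have "\<dots> \<le> (\<integral>\<^sup>+x. ennreal (w x) \<partial>lebesgue_on S)"
    using le by (intro nn_integral_mono_AE) (auto intro: ennreal_leI)
  also have "\<dots> = ennreal W"
    by (intro nn_integral_lebesgue_on_has_integral w S)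
  finally show ?thesis
    using has_integral_nonneg[OF w] by simp
qed

lemma bintegrable_on_has_integral:
  fixes f :: "real \<Rightarrow> 'a::banach"
  assumes f: "strongly_measurable (lebesgue_on S) f"
    and w: "(w has_integral W) S" "\<And>x. x \<in> S \<Longrightarrow> 0 \<le> w x"
    and S: "S \<in> sets lebesgue" and le: "AE x in lebesgue_on S. norm (f x) \<le> w x"
  shows "bintegrable_on S f"
proof -
  have "(\<integral>\<^sup>+x. ennreal (norm (f x)) \<partial>lebesgue_on S) \<le> (\<integral>\<^sup>+x. ennreal (w x) \<partial>lebesgue_on S)"
    using le by (intro nn_integral_mono_AE) (auto intro: ennreal_leI)
  also have "\<dots> = ennreal W"
    by (intro nn_integral_lebesgue_on_has_integral w S)
  finally show ?thesis
    using f unfolding bintegrable_on_iff by (auto simp: le_less_trans)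
qed

text \<open>\<open>N\<close> is the L1 norm of \<open>z\<close>. It is fixed before \<open>f\<close>
  and \<open>c\<close>, which gives bounds uniform over a family of integrands, such as the history
  integrands indexed by the time \<open>s\<close>.\<close>

lemma bint_on_norm_le_const_mult:
  fixes z :: "real \<Rightarrow> 'b::banach"
  assumes z: "bintegrable_on S z"
  obtains N where "0 \<le> N" "\<And>f :: real \<Rightarrow> 'a::banach. \<And>c. \<lbrakk>bintegrable_on S f; 0 \<le> c;
      AE x in lebesgue_on S. norm (f x) \<le> c * norm (z x)\<rbrakk> \<Longrightarrow> norm (bint_on S f) \<le> c * N"
proof -
  obtain g where g: "g \<in> borel_measurable (lebesgue_on S)" "AE x in lebesgue_on S. norm (z x) = g x"
    "\<And>x. 0 \<le> g x"
    using strongly_measurable_norm_AE[OF bintegrable_on_measurable[OF z], of thesis] by blast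
  define N where "N = enn2real (\<integral>\<^sup>+x. ennreal (g x) \<partial>lebesgue_on S)"
  have eq: "(\<integral>\<^sup>+x. ennreal (g x) \<partial>lebesgue_on S) = (\<integral>\<^sup>+x. ennreal (norm (z x)) \<partial>lebesgue_on S)"
    using g(2) by (intro nn_integral_cong_AE) auto
  have N: "(\<integral>\<^sup>+x. ennreal (g x) \<partial>lebesgue_on S) = ennreal N"
    using z unfolding eq N_def bintegrable_on_iff by (simp add: less_top)
  show thesis
  proof
    show "0 \<le> N" by (simp add: N_def)
    fix f :: "real \<Rightarrow> 'a" and c
    assume f: "bintegrable_on S f" and c: "0 \<le> c"
      and le: "AE x in lebesgue_on S. norm (f x) \<le> c * norm (z x)"
    have "ennreal (norm (bint_on S f)) \<le> (\<integral>\<^sup>+x. ennreal (norm (f x)) \<partial>lebesgue_on S)"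
      by (intro has_bint_norm_le has_bint_bint_on f)
    also have "\<dots> \<le> (\<integral>\<^sup>+x. ennreal c * ennreal (g x) \<partial>lebesgue_on S)"
    proof (intro nn_integral_mono_AE)
      show "AE x in lebesgue_on S. ennreal (norm (f x)) \<le> ennreal c * ennreal (g x)"
        using le g(2)
      proof eventually_elim
        case (elim x)
        then have "norm (f x) \<le> c * g x" by simp
        from ennreal_leI[OF this] show ?case using c by (simp add: ennreal_mult')
      qed
    qed
    also have "\<dots> = ennreal c * ennreal N"
      using g(1) unfolding N[symmetric] by (intro nn_integral_cmult) auto
    also have "\<dots> = ennreal (c * N)"
      using c by (simp add: ennreal_mult')
    finally show "norm (bint_on S f) \<le> c * N"
      using c \<open>0 \<le> N\<close> by simp
  qed
qed

text \<open>Reduced to the scalar theorem for \<open>norm (f n x - g x)\<close>, which is dominated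
  by twice \<open>norm (w x)\<close>; the norm bound for the integral of the difference does the
  rest.\<close>

lemma bint_on_dominated_convergence:
  fixes g :: "real \<Rightarrow> 'a::banach" and w :: "real \<Rightarrow> 'b::banach"
  assumes f: "\<And>n::nat. strongly_measurable (lebesgue_on S) (f n)"
    and g: "strongly_measurable (lebesgue_on S) g"
    and w: "bintegrable_on S w"
    and le: "\<And>n. AE x in lebesgue_on S. norm (f n x) \<le> norm (w x)"
    and lim: "AE x in lebesgue_on S. (\<lambda>n. f n x) \<longlonglongrightarrow> g x"
  shows "(\<lambda>n. bint_on S (f n)) \<longlonglongrightarrow> bint_on S g"
proof -
  let ?M = "lebesgue_on S"
  have le': "AE x in ?M. \<forall>n. norm (f n x) \<le> norm (w x)"
    using le by (simp add: AE_all_countable)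
  have le_g: "AE x in ?M. norm (g x) \<le> norm (w x)"
    using le' lim
  proof eventually_elim
    case (elim x)
    then show ?case
      by (intro LIMSEQ_le_const2[OF tendsto_norm[OF elim(2)]]) auto
  qed
  have fi: "bintegrable_on S (f n)" for n
    by (rule bintegrable_on_bound[OF f w le])
  have gi: "bintegrable_on S g"
    by (rule bintegrable_on_bound[OF g w le_g])
  obtain w' where w': "w' \<in> borel_measurable ?M" "AE x in ?M. norm (w x) = w' x" "\<And>x. 0 \<le> w' x"
    using strongly_measurable_norm_AE[OF bintegrable_on_measurable[OF w], of thesis] by blast
  have "\<exists>d. d \<in> borel_measurable ?M \<and> (AE x in ?M. norm (f n x - g x) = d x)" for n
    by (rule strongly_measurable_norm_AE[OF strongly_measurable_diff[OF f[of n] g]]) blast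
  then have "\<forall>n. \<exists>d. d \<in> borel_measurable ?M \<and> (AE x in ?M. norm (f n x - g x) = d x)" by blast
  from choice[OF this] obtain d where d: "\<And>n. d n \<in> borel_measurable ?M"
    "\<And>n. AE x in ?M. norm (f n x - g x) = d n x" by blast
  have d': "AE x in ?M. \<forall>n. norm (f n x - g x) = d n x"
    using d(2) by (simp add: AE_all_countable)
  have "(\<lambda>n. \<integral>\<^sup>+x. ennreal (d n x) \<partial>?M) \<longlonglongrightarrow> (\<integral>\<^sup>+x. 0 \<partial>?M)"
  proof (rule nn_integral_dominated_convergence[where w = "\<lambda>x. 2 * ennreal (w' x)"])
    show "AE x in ?M. ennreal (d n x) \<le> 2 * ennreal (w' x)" for n
      using d' le' le_g w'(2)
    proof eventually_elim
      case (elim x)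
      have "norm (f n x - g x) \<le> norm (f n x) + norm (g x)"
        by (rule norm_triangle_ineq4)
      also have "\<dots> \<le> norm (w x) + norm (w x)"
        using elim by (intro add_mono) auto
      finally have "d n x \<le> 2 * w' x"
        using elim(1,4) by auto
      from ennreal_leI[OF this] show ?case by (simp add: ennreal_mult')
    qed
    have "(\<integral>\<^sup>+x. ennreal (w' x) \<partial>?M) = (\<integral>\<^sup>+x. ennreal (norm (w x)) \<partial>?M)"
      using w'(2) by (intro nn_integral_cong_AE) auto
    then show "(\<integral>\<^sup>+x. 2 * ennreal (w' x) \<partial>?M) < \<infinity>"
      using w w'(1) unfolding bintegrable_on_iff
      by (subst nn_integral_cmult) (auto simp: ennreal_mult_less_top)
    show "AE x in ?M. (\<lambda>n. ennreal (d n x)) \<longlonglongrightarrow> 0"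
      using d' lim
    proof eventually_elim
      case (elim x)
      have "(\<lambda>n. norm (f n x - g x)) \<longlonglongrightarrow> norm (g x - g x)"
        by (intro tendsto_intros elim(2))
      then have "(\<lambda>n. d n x) \<longlonglongrightarrow> 0" using elim(1) by simp
      then show ?case
        using tendsto_ennrealI by force
    qed
  qed (use d(1) w'(1) in auto)
  then have lim0: "(\<lambda>n. \<integral>\<^sup>+x. ennreal (d n x) \<partial>?M) \<longlonglongrightarrow> 0"
    by simp
  have le0: "ennreal (norm (bint_on S (f n) - bint_on S g)) \<le> (\<integral>\<^sup>+x. ennreal (d n x) \<partial>?M)" for n
  proof -
    have "ennreal (norm (bint_on S (f n) - bint_on S g)) \<le> (\<integral>\<^sup>+x. ennreal (norm (f n x - g x)) \<partial>?M)"
      by (intro has_bint_norm_le has_bint_diff has_bint_bint_on fi gi)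
    also have "\<dots> = (\<integral>\<^sup>+x. ennreal (d n x) \<partial>?M)"
      using d(2)[of n] by (intro nn_integral_cong_AE) auto
    finally show ?thesis .
  qed
  have "(\<lambda>n. ennreal (norm (bint_on S (f n) - bint_on S g))) \<longlonglongrightarrow> 0"
    by (rule tendsto_sandwich[OF _ _ tendsto_const lim0]) (use le0 in auto)
  then have "(\<lambda>n. norm (bint_on S (f n) - bint_on S g)) \<longlonglongrightarrow> 0"
    by (simp flip: ennreal_0)
  then show ?thesis
    by (simp add: tendsto_norm_zero_iff LIM_zero_iff)
qed

lemma strongly_measurable_lebesgue_on_subset:
  assumes "strongly_measurable (lebesgue_on T) f" "S \<subseteq> T" "S \<in> sets lebesgue" "T \<in> sets lebesgue"
  shows "strongly_measurable (lebesgue_on S) f"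
proof -
  have "lebesgue_on S = restrict_space (lebesgue_on T) S"
    using assms by (subst restrict_restrict_space) (auto simp: Int_absorb1)
  moreover have "S \<in> sets (lebesgue_on T)"
    using assms by (subst sets_restrict_space_iff) auto
  ultimately show ?thesis
    using strongly_measurable_restrict_space[OF assms(1)] by simp
qed

lemma bintegrable_on_subset:
  fixes f :: "real \<Rightarrow> 'a::banach"
  assumes f: "bintegrable_on T f" and ST: "S \<subseteq> T" "S \<in> sets lebesgue" "T \<in> sets lebesgue"
  shows "bintegrable_on S f"
proof -
  have "(\<integral>\<^sup>+x. ennreal (norm (f x)) \<partial>lebesgue_on S) \<le> (\<integral>\<^sup>+x. ennreal (norm (f x)) \<partial>lebesgue_on T)"
    using ST by (simp add: nn_integral_restrict_space) (intro nn_integral_mono, auto simp: indicator_def)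
  then show ?thesis
    using f strongly_measurable_lebesgue_on_subset[OF _ ST] unfolding bintegrable_on_iff by auto
qed

text \<open>Turns integrals over varying intervals into integrals over one fixed interval, as
  dominated convergence requires.\<close>

lemma bint_on_extend:
  fixes f :: "real \<Rightarrow> 'a::real_normed_vector"
  assumes f: "bintegrable_on S f" and ST: "S \<subseteq> T" "S \<in> sets lebesgue" "T \<in> sets lebesgue"
  shows "bintegrable_on T (\<lambda>x. if x \<in> S then f x else 0)"
    and "bint_on T (\<lambda>x. if x \<in> S then f x else 0) = bint_on S f"
proof -
  have "lebesgue_on S = restrict_space (lebesgue_on T) S"
    using ST by (subst restrict_restrict_space) (auto simp: Int_absorb1)
  moreover have "S \<inter> space (lebesgue_on T) \<in> sets (lebesgue_on T)"
    using ST by (subst sets_restrict_space_iff) (auto simp: Int_absorb2)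
  ultimately have "has_bint (lebesgue_on T) (\<lambda>x. indicator S x *\<^sub>R f x) (bint_on S f)"
    using has_bint_restrict_space[of S "lebesgue_on T" f "bint_on S f"] has_bint_bint_on[OF f] by simp
  moreover have "(\<lambda>x. indicator S x *\<^sub>R f x) = (\<lambda>x. if x \<in> S then f x else 0)"
    by (auto simp: indicator_def)
  ultimately have "has_bint (lebesgue_on T) (\<lambda>x. if x \<in> S then f x else 0) (bint_on S f)"
    by simp
  then show "bintegrable_on T (\<lambda>x. if x \<in> S then f x else 0)"
      "bint_on T (\<lambda>x. if x \<in> S then f x else 0) = bint_on S f"
    unfolding bintegrable_on_def by (auto intro: bint_on_eqI)
qed

section \<open>Integrands on compact real intervals\<close>

lemma AE_lebesgue_on_finite:
  fixes S F :: "real set"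
  assumes "finite F" "S \<in> sets lebesgue" "\<And>x. x \<in> S - F \<Longrightarrow> P x"
  shows "AE x in lebesgue_on S. P x"
proof (rule AE_I'[of "F \<inter> S"])
  have "negligible (F \<inter> S)"
    using assms(1) by (intro negligible_finite) auto
  then show "F \<inter> S \<in> null_sets (lebesgue_on S)"
    using assms(2) by (simp add: null_sets_restrict_space negligible_iff_null_sets)
  show "{x \<in> space (lebesgue_on S). \<not> P x} \<subseteq> F \<inter> S"
    using assms(3) by auto
qed

text \<open>Endpoints are negligible. Hence later pointwise claims concern open intervals only, away
  from the singularity of the resolvent and from the jumps of the solution.\<close>

lemma AE_lebesgue_on_interval:
  fixes a b :: real
  assumes "\<And>x. x \<in> {a<..<b} \<Longrightarrow> P x"
  shows "AE x in lebesgue_on {a..b}. P x"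
  using assms by (intro AE_lebesgue_on_finite[of "{a, b}"]) force+

lemma has_bint_interval_cong:
  fixes a b :: real
  assumes "\<And>x. x \<in> {a<..<b} \<Longrightarrow> f x = g x"
  shows "has_bint (lebesgue_on {a..b}) f = has_bint (lebesgue_on {a..b}) g"
proof (rule ext, rule iffI)
  fix v
  show "has_bint (lebesgue_on {a..b}) g v" if "has_bint (lebesgue_on {a..b}) f v"
    by (rule has_bint_cong_AE[OF AE_lebesgue_on_interval that]) (use assms in auto)
  show "has_bint (lebesgue_on {a..b}) f v" if "has_bint (lebesgue_on {a..b}) g v"
    by (rule has_bint_cong_AE[OF AE_lebesgue_on_interval that]) (use assms in auto)
qed

text \<open>Non-integrable integrands are covered as well: both sides then take the default value of
  \<open>bint_on\<close>.\<close>

lemma bint_on_interval_cong: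
  fixes a b :: real
  assumes "\<And>x. x \<in> {a<..<b} \<Longrightarrow> f x = g x"
  shows "bint_on {a..b} f = bint_on {a..b} g" "bintegrable_on {a..b} f = bintegrable_on {a..b} g"
  unfolding bint_on_def bintegrable_on_def
  using has_bint_interval_cong[of a b f g] assms by auto

lemma strongly_measurable_continuous_interval:
  fixes a b :: real and f :: "real \<Rightarrow> 'a::real_normed_vector"
  assumes f: "continuous_on {a<..<b} f"
  shows "strongly_measurable (lebesgue_on {a..b}) f"
proof (cases "a < b")
  case False
  have "AE x in lebesgue_on {a..b}. 0 = f x"
    by (rule AE_lebesgue_on_interval) (use False in auto)
  then show ?thesis
    by (rule strongly_measurable_cong_AE) (auto intro: strongly_measurable_simple_function)
next
  case True
  \<comment> \<open>Rounding down to a grid of \<open>Suc n\<close> equal steps. The function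
    \<open>p n\<close> has finitely many values, so \<open>f (p n x)\<close> is simple in
    \<open>x\<close> whatever \<open>f\<close> does at the endpoints; at interior points continuity
    gives convergence.\<close>
  define p where "p n x = a + (b - a) * (of_int \<lfloor>real (Suc n) * ((x - a) / (b - a))\<rfloor> / real (Suc n))" for n x
  have p_simple: "simple_function (lebesgue_on {a..b}) (p n)" for n
  proof (rule simple_function_borel_measurable)
    have "(\<lambda>x. real_of_int \<lfloor>real (Suc n) * ((x - a) / (b - a))\<rfloor>) \<in> borel_measurable borel"
      by measurable
    then have "p n \<in> borel_measurable borel"
      unfolding p_def by measurable
    then show "p n \<in> borel_measurable (lebesgue_on {a..b})"
      by (intro measurable_restrict_space1 measurable_completion) simp
    have "p n ` {a..b} \<subseteq> (\<lambda>k. a + (b - a) * (of_int k / real (Suc n))) ` {0..int (Suc n)}"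
    proof
      fix y assume "y \<in> p n ` {a..b}"
      then obtain x where x: "x \<in> {a..b}" "y = p n x" by blast
      have "0 \<le> (x - a) / (b - a)" "(x - a) / (b - a) \<le> 1"
        using x True by (auto simp: divide_simps)
      then have "0 \<le> real (Suc n) * ((x - a) / (b - a))"
        "real (Suc n) * ((x - a) / (b - a)) \<le> real (Suc n) * 1"
        by (intro mult_nonneg_nonneg mult_left_mono; simp)+
      then have "\<lfloor>real (Suc n) * ((x - a) / (b - a))\<rfloor> \<in> {0..int (Suc n)}"
        by (simp add: floor_le_iff)
      then show "y \<in> (\<lambda>k. a + (b - a) * (of_int k / real (Suc n))) ` {0..int (Suc n)}"
        unfolding x p_def by (rule imageI)
    qed
    then show "finite (p n ` space (lebesgue_on {a..b}))"
      by (simp add: finite_subset)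
  qed
  have p_lim: "(\<lambda>n. p n x) \<longlonglongrightarrow> x" for x
  proof -
    let ?y = "(x - a) / (b - a)"
    have "(\<lambda>n. of_int \<lfloor>real (Suc n) * ?y\<rfloor> / real (Suc n)) \<longlonglongrightarrow> ?y"
    proof (rule tendsto_sandwich[of "\<lambda>n. ?y - 1 / real (Suc n)" _ _ "\<lambda>n. ?y"])
      show "\<forall>\<^sub>F n in sequentially. ?y - 1 / real (Suc n) \<le> of_int \<lfloor>real (Suc n) * ?y\<rfloor> / real (Suc n)"
      proof (intro always_eventually allI)
        fix n
        have "real (Suc n) * ?y - 1 \<le> of_int \<lfloor>real (Suc n) * ?y\<rfloor>" by linarith
        then have "(real (Suc n) * ?y - 1) / real (Suc n) \<le> of_int \<lfloor>real (Suc n) * ?y\<rfloor> / real (Suc n)"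
          by (rule divide_right_mono) simp
        then show "?y - 1 / real (Suc n) \<le> of_int \<lfloor>real (Suc n) * ?y\<rfloor> / real (Suc n)"
          by (simp add: diff_divide_distrib del: of_nat_Suc)
      qed
      show "\<forall>\<^sub>F n in sequentially. of_int \<lfloor>real (Suc n) * ?y\<rfloor> / real (Suc n) \<le> ?y"
      proof (intro always_eventually allI)
        fix n
        have "of_int \<lfloor>real (Suc n) * ?y\<rfloor> / real (Suc n) \<le> (real (Suc n) * ?y) / real (Suc n)"
          by (rule divide_right_mono) (simp_all del: of_nat_Suc)
        then show "of_int \<lfloor>real (Suc n) * ?y\<rfloor> / real (Suc n) \<le> ?y"
          by (simp del: of_nat_Suc)
      qed
      have "(\<lambda>n. ?y - 1 / real (Suc n)) \<longlonglongrightarrow> ?y - 0"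
        by (intro tendsto_diff tendsto_const lim_1_over_n[THEN LIMSEQ_Suc])
      then show "(\<lambda>n. ?y - 1 / real (Suc n)) \<longlonglongrightarrow> ?y" by simp
    qed simp
    then have "(\<lambda>n. p n x) \<longlonglongrightarrow> a + (b - a) * ?y"
      unfolding p_def by (intro tendsto_add tendsto_mult tendsto_const)
    then show ?thesis using True by simp
  qed
  have "AE x in lebesgue_on {a..b}. (\<lambda>n. f (p n x)) \<longlonglongrightarrow> f x"
  proof (rule AE_lebesgue_on_interval)
    fix x assume "x \<in> {a<..<b}"
    then have "isCont f x"
      using f by (simp add: continuous_on_eq_continuous_at)
    then show "(\<lambda>n. f (p n x)) \<longlonglongrightarrow> f x"
      by (rule isCont_tendsto_compose[OF _ p_lim])
  qed
  moreover have "simple_function (lebesgue_on {a..b}) (\<lambda>x. f (p n x))" for n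
    by (rule simple_function_compose1[OF p_simple])
  ultimately show ?thesis
    unfolding strongly_measurable_def by (intro exI[of _ "\<lambda>n x. f (p n x)"] conjI allI)
qed

lemma emeasure_lebesgue_on_interval_finite:
  fixes a b :: real
  shows "emeasure (lebesgue_on {a..b}) (space (lebesgue_on {a..b})) < \<infinity>"
  by (simp add: emeasure_restrict_space emeasure_lborel_Icc_eq)

text \<open>Applied with the exponent \<open>\<beta> - 2\<close>, which exceeds -1; this is the
  integrability of the resolvent singularity.\<close>

lemma bintegrable_on_powr:
  fixes c d p :: real
  assumes "-1 < p"
  shows "bintegrable_on {c..d} (\<lambda>s. (s - c) powr p)"
proof (cases "c \<le> d")
  case True
  have "((\<lambda>x. x powr p) has_integral ((d - c) powr (p + 1) / (p + 1))) {0..d - c}"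
    using has_integral_powr_from_0[of p "d - c"] assms True by simp
  then have I: "((\<lambda>x. (x - c) powr p) has_integral ((d - c) powr (p + 1) / (p + 1))) {c..d}"
    using has_integral_affinity'[of "\<lambda>x. x powr p" _ 0 "d - c" 1 "- c"] by simp
  show ?thesis
  proof (rule bintegrable_on_has_integral[OF _ I])
    show "strongly_measurable (lebesgue_on {c..d}) (\<lambda>s. (s - c) powr p)"
      by (intro strongly_measurable_continuous_interval continuous_intros) auto
  qed auto
next
  case False
  show ?thesis
  proof (rule bintegrable_on_has_integral[where w = "\<lambda>_. 0" and W = 0])
    show "strongly_measurable (lebesgue_on {c..d}) (\<lambda>s. (s - c) powr p)"
      by (rule strongly_measurable_continuous_interval) (use False in simp)
  qed (use False in auto)
qed

lemma bintegrable_on_bounded: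
  fixes f :: "real \<Rightarrow> 'a::banach"
  assumes f: "strongly_measurable (lebesgue_on {c..d}) f"
    and le: "\<And>x. x \<in> {c<..<d} \<Longrightarrow> norm (f x) \<le> B"
  shows "bintegrable_on {c..d} f"
proof (rule bintegrable_on_has_integral[OF f])
  show "((\<lambda>_. max B 0) has_integral (max B 0 * measure lborel {c..d})) {c..d}"
    using has_integral_const_real[of "max B 0" c d] by (simp add: mult.commute)
  show "AE x in lebesgue_on {c..d}. norm (f x) \<le> max B 0"
    using le by (intro AE_lebesgue_on_interval) force
qed auto

lemma continuous_interval_bounded:
  fixes w :: "real \<Rightarrow> 'a::real_normed_vector"
  assumes "continuous_on {c..d} w"
  obtains B where "0 \<le> B" "\<And>x. x \<in> {c..d} \<Longrightarrow> norm (w x) \<le> B"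
proof -
  have "bounded (w ` {c..d})"
    using assms by (intro compact_imp_bounded compact_continuous_image) auto
  then obtain B where "\<And>x. x \<in> {c..d} \<Longrightarrow> norm (w x) \<le> B"
    unfolding bounded_iff by (metis imageI)
  then show thesis
    using that[of "max B 0"] by force
qed

lemma continuous_bintegrable_interval:
  fixes w :: "real \<Rightarrow> 'a::banach"
  assumes "continuous_on {c..d} w"
  shows "bintegrable_on {c..d} w"
proof -
  obtain B where "\<And>x. x \<in> {c..d} \<Longrightarrow> norm (w x) \<le> B"
    using continuous_interval_bounded[OF assms, of thesis] by blast
  then show ?thesis
    by (intro bintegrable_on_bounded[of c d w B] strongly_measurable_continuous_interval
        continuous_on_subset[OF assms]) auto
qed

text \<open>The upper limit and the parameter of the kernel move together. Extending the kernel by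
  zero past the diagonal fixes the domain, and dominated convergence along sequences applies;
  continuity of the kernel is asked only off the diagonal \<open>s = r\<close>.\<close>

lemma continuous_on_bint_on_upper:
  fixes K :: "real \<Rightarrow> real \<Rightarrow> 'a::banach" and w :: "real \<Rightarrow> 'b::banach"
  assumes K: "\<And>s. s \<in> {c..d} \<Longrightarrow> bintegrable_on {c..s} (K s)"
    and w: "bintegrable_on {c..d} w"
    and le: "\<And>s r. s \<in> {c..d} \<Longrightarrow> r \<in> {c<..<s} \<Longrightarrow> norm (K s r) \<le> norm (w r)"
    and cont: "\<And>r. r \<in> {c<..<d} \<Longrightarrow> continuous_on {r<..d} (\<lambda>s. K s r)"
  shows "continuous_on {c..d} (\<lambda>s. bint_on {c..s} (K s))"
  unfolding continuous_on_sequentially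
proof (intro allI ballI impI)
  fix x :: "nat \<Rightarrow> real" and s
  assume s: "s \<in> {c..d}" and "(\<forall>n. x n \<in> {c..d}) \<and> x \<longlonglongrightarrow> s"
  then have x: "\<And>n. x n \<in> {c..d}" and lim: "x \<longlonglongrightarrow> s" by auto
  define E where "E t r = (if r \<in> {c..t} then K t r else 0)" for t r
  have E: "bintegrable_on {c..d} (E t)" "bint_on {c..d} (E t) = bint_on {c..t} (K t)" if "t \<in> {c..d}" for t
    using bint_on_extend[OF K[OF that], of "{c..d}"] that unfolding E_def by auto
  have "(\<lambda>n. bint_on {c..d} (E (x n))) \<longlonglongrightarrow> bint_on {c..d} (E s)"
  proof (rule bint_on_dominated_convergence[OF _ _ w])
    show "strongly_measurable (lebesgue_on {c..d}) (E (x n))" for n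
      by (rule bintegrable_on_measurable[OF E(1)[OF x]])
    show "strongly_measurable (lebesgue_on {c..d}) (E s)"
      by (rule bintegrable_on_measurable[OF E(1)[OF s]])
    show "AE r in lebesgue_on {c..d}. norm (E (x n) r) \<le> norm (w r)" for n
      by (rule AE_lebesgue_on_finite[of "{c, x n}"]) (use x[of n] le[of "x n"] in \<open>auto simp: E_def\<close>)
    show "AE r in lebesgue_on {c..d}. (\<lambda>n. E (x n) r) \<longlonglongrightarrow> E s r"
    \<comment> \<open>The diagonal point \<open>r = s\<close> is discarded: there the extension by
      zero can jump along the sequence.\<close>
    proof (rule AE_lebesgue_on_finite[of "{c, s, d}"])
      fix r assume r: "r \<in> {c..d} - {c, s, d}"
      show "(\<lambda>n. E (x n) r) \<longlonglongrightarrow> E s r"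
      proof (cases "r < s")
        case True
        have ev: "\<forall>\<^sub>F n in sequentially. x n \<in> {r<..d}"
          using order_tendstoD(1)[OF lim True] by eventually_elim (use x in auto)
        have "continuous_on {r<..d} (\<lambda>t. K t r)"
          using cont r by auto
        then have "(\<lambda>n. K (x n) r) \<longlonglongrightarrow> K s r"
          by (rule continuous_on_tendsto_compose[OF _ lim]) (use True s ev in auto)
        moreover have "\<forall>\<^sub>F n in sequentially. K (x n) r = E (x n) r"
          using ev by eventually_elim (use r in \<open>auto simp: E_def\<close>)
        ultimately have "(\<lambda>n. E (x n) r) \<longlonglongrightarrow> K s r"
          by (rule Lim_transform_eventually)
        then show ?thesis
          using True r by (simp add: E_def)
      next
        case False
        then have "s < r" using r by auto
        from order_tendstoD(2)[OF lim this]
        have "\<forall>\<^sub>F n in sequentially. 0 = E (x n) r"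
          by eventually_elim (auto simp: E_def)
        then have "(\<lambda>n. E (x n) r) \<longlonglongrightarrow> 0"
          by (rule Lim_transform_eventually[OF tendsto_const])
        then show ?thesis
          using \<open>s < r\<close> by (simp add: E_def)
      qed
    qed auto
  qed
  then show "((\<lambda>s. bint_on {c..s} (K s)) \<circ> x) \<longlonglongrightarrow> bint_on {c..s} (K s)"
    using E(2)[OF s] E(2)[OF x] by (simp add: comp_def)
qed

section \<open>Volterra equations with a weakly singular operator family\<close>

locale singular_family =
  fixes R :: "real \<Rightarrow> 'a::banach \<Rightarrow>\<^sub>L 'a" and \<beta> lR a :: real
  assumes beta: "1 < \<beta>" and a_pos: "0 < a"
    and continuous_R: "\<And>v. continuous_on {0<..} (\<lambda>s. blinfun_apply (R s) v)"
    and R_bound: "\<And>s. s \<in> {0<..a} \<Longrightarrow> norm (s powr (2 - \<beta>) *\<^sub>R R s) \<le> lR"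
begin

lemma lR_nonneg: "0 \<le> lR"
  using order.trans[OF norm_ge_zero R_bound[of a]] a_pos by simp

lemma norm_R_le:
  assumes s: "s \<in> {0<..a}"
  shows "norm (blinfun_apply (R s) v) \<le> lR * norm v * s powr (\<beta> - 2)"
proof -
  have "s powr (2 - \<beta>) * norm (R s) \<le> lR"
    using R_bound[OF s] by simp
  then have "s powr (\<beta> - 2) * (s powr (2 - \<beta>) * norm (R s)) \<le> s powr (\<beta> - 2) * lR"
    by (intro mult_left_mono) auto
  also have "s powr (\<beta> - 2) * (s powr (2 - \<beta>) * norm (R s)) = norm (R s)"
    using s by (simp add: mult.assoc[symmetric] powr_add[symmetric])
  finally have "norm (R s) * norm v \<le> s powr (\<beta> - 2) * lR * norm v"
    by (intro mult_right_mono) auto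
  then show ?thesis
    using norm_blinfun[of "R s" v] by (simp add: mult_ac)
qed

text \<open>The majorant is a multiple of \<open>(p - c) powr (\<beta> - 2)\<close>. The shift by
  \<open>c\<close> serves the intervals that start at \<open>u j\<close>.\<close>

lemma bintegrable_R:
  assumes "x \<le> c + a"
  shows "bintegrable_on {c..x} (\<lambda>p. blinfun_apply (R (p - c)) v)"
proof (rule bintegrable_on_bound)
  show "strongly_measurable (lebesgue_on {c..x}) (\<lambda>p. blinfun_apply (R (p - c)) v)"
    by (intro strongly_measurable_continuous_interval continuous_on_compose2[OF continuous_R] continuous_intros) auto
  show "bintegrable_on {c..x} (\<lambda>p. (lR * norm v) *\<^sub>R (p - c) powr (\<beta> - 2))"
    using beta by (intro bintegrable_on_scaleR_const bintegrable_on_powr) auto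
  show "AE p in lebesgue_on {c..x}. norm (blinfun_apply (R (p - c)) v) \<le> norm ((lR * norm v) *\<^sub>R (p - c) powr (\<beta> - 2))"
  proof (rule AE_lebesgue_on_interval)
    fix p assume "p \<in> {c<..<x}"
    then have "p - c \<in> {0<..a}" using assms by auto
    from norm_R_le[OF this, of v] lR_nonneg
    show "norm (blinfun_apply (R (p - c)) v) \<le> norm ((lR * norm v) *\<^sub>R (p - c) powr (\<beta> - 2))"
      by simp
  qed
qed

lemma continuous_on_bint_R:
  "continuous_on {c..c + a} (\<lambda>x. bint_on {c..x} (\<lambda>p. blinfun_apply (R (p - c)) v))"
proof (rule continuous_on_bint_on_upper)
  show "bintegrable_on {c..s} (\<lambda>p. blinfun_apply (R (p - c)) v)" if "s \<in> {c..c + a}" for s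
    using bintegrable_R that by auto
  show "bintegrable_on {c..c + a} (\<lambda>p. blinfun_apply (R (p - c)) v)"
    by (intro bintegrable_R) auto
qed auto

text \<open>The integrated resolvent, kept as a function of two arguments instead of a bounded
  operator; its linearity is used only in the form \<open>S_diff\<close>.\<close>

definition S :: "real \<Rightarrow> 'a \<Rightarrow> 'a" where
  "S x v = bint_on {0..x} (\<lambda>p. blinfun_apply (R p) v)"

lemma S_diff: "x \<le> a \<Longrightarrow> S x (v - w) = S x v - S x w"
  unfolding S_def using bint_on_diff[OF bintegrable_R[of x 0 v] bintegrable_R[of x 0 w]]
  by (simp add: blinfun.diff_right)

lemma continuous_S: "continuous_on {0..a} (\<lambda>x. S x v)"
  using continuous_on_bint_R[of 0 v] unfolding S_def by simp

text \<open>The integral of \<open>lR * s powr (\<beta> - 2)\<close> over the interval from 0 to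
  \<open>a\<close>, hence a bound for all operators \<open>S x\<close> with \<open>x\<close> in that
  interval.\<close>

definition M where "M = lR * (a powr (\<beta> - 1) / (\<beta> - 1))"

lemma M_nonneg: "0 \<le> M"
  unfolding M_def using lR_nonneg beta by simp

lemma norm_S_le:
  assumes x: "x \<in> {0..a}"
  shows "norm (S x v) \<le> M * norm v"
proof -
  have "norm (S x v) \<le> lR * norm v * (x powr (\<beta> - 1) / (\<beta> - 1))"
    unfolding S_def
  proof (rule bint_on_norm_le)
    show "bintegrable_on {0..x} (\<lambda>p. blinfun_apply (R p) v)"
      using bintegrable_R[of x 0 v] x by simp
    show "((\<lambda>p. lR * norm v * p powr (\<beta> - 2)) has_integral lR * norm v * (x powr (\<beta> - 1) / (\<beta> - 1))) {0..x}"
      using has_integral_mult_right[OF has_integral_powr_from_0[of "\<beta> - 2" x], of "lR * norm v"] beta x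
      by (simp add: algebra_simps)
    show "AE p in lebesgue_on {0..x}. norm (blinfun_apply (R p) v) \<le> lR * norm v * p powr (\<beta> - 2)"
      by (intro AE_lebesgue_on_interval norm_R_le) (use x in auto)
  qed (use lR_nonneg in auto)
  also have "\<dots> \<le> lR * norm v * (a powr (\<beta> - 1) / (\<beta> - 1))"
    using x beta lR_nonneg by (intro mult_left_mono divide_right_mono powr_mono2) auto
  finally show ?thesis
    by (simp add: M_def mult_ac)
qed

lemma continuous_S_apply:
  assumes x: "x \<in> {0..a}"
  shows "continuous_on UNIV (S x)"
proof (rule lipschitz_on_continuous_on)
  show "M-lipschitz_on UNIV (S x)"
  proof (rule lipschitz_onI[OF _ M_nonneg])
    show "dist (S x v) (S x w) \<le> M * dist v w" for v w
      using norm_S_le[OF x, of "v - w"] S_diff[of x v w] x by (simp add: dist_norm)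
  qed
qed

text \<open>\<open>S\<close> is continuous in time for each vector and \<open>M\<close>-Lipschitz in
  the vector, so the Caratheodory lemma yields measurability; the majorant is \<open>M\<close> times
  \<open>g\<close>.\<close>

lemma bintegrable_S:
  assumes g: "bintegrable_on {c..d} g" and s: "s \<in> {c..d}" and d: "d \<le> c + a"
  shows "bintegrable_on {c..s} (\<lambda>r. S (s - r) (g r))"
proof (rule bintegrable_on_bound)
  have g': "bintegrable_on {c..s} g"
    by (rule bintegrable_on_subset[OF g]) (use s in auto)
  show "strongly_measurable (lebesgue_on {c..s}) (\<lambda>r. S (s - r) (g r))"
  proof (rule strongly_measurable_caratheodory[OF emeasure_lebesgue_on_interval_finite, where k = "\<lambda>r. S (s - r)"])
    show "strongly_measurable (lebesgue_on {c..s}) (\<lambda>r. S (s - r) v)" for v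
      by (intro strongly_measurable_continuous_interval continuous_on_compose2[OF continuous_S] continuous_intros)
        (use s d in auto)
    show "continuous_on UNIV (S (s - r))" if "r \<in> space (lebesgue_on {c..s})" for r
      using that s d by (intro continuous_S_apply) auto
  qed (rule bintegrable_on_measurable[OF g'])
  show "bintegrable_on {c..s} (\<lambda>r. M *\<^sub>R g r)"
    by (rule bintegrable_on_scaleR_const[OF g'])
  show "AE r in lebesgue_on {c..s}. norm (S (s - r) (g r)) \<le> norm (M *\<^sub>R g r)"
    by (rule AE_lebesgue_on_interval) (use s d norm_S_le M_nonneg in auto)
qed

lemma continuous_on_bint_S:
  assumes g: "bintegrable_on {c..d} g" and d: "d \<le> c + a"
  shows "continuous_on {c..d} (\<lambda>s. bint_on {c..s} (\<lambda>r. S (s - r) (g r)))"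
proof (rule continuous_on_bint_on_upper)
  show "bintegrable_on {c..d} (\<lambda>r. M *\<^sub>R g r)"
    by (rule bintegrable_on_scaleR_const[OF g])
  show "norm (S (s - r) (g r)) \<le> norm (M *\<^sub>R g r)" if "s \<in> {c..d}" "r \<in> {c<..<s}" for s r
    using that d norm_S_le[of "s - r" "g r"] M_nonneg by auto
  show "continuous_on {r<..d} (\<lambda>s. S (s - r) (g r))" if "r \<in> {c<..<d}" for r
    by (intro continuous_on_compose2[OF continuous_S] continuous_intros) (use that d in auto)
qed (rule bintegrable_S[OF g _ d])

end

section \<open>The Volterra equation on a single interval\<close>

locale volterra_equation = singular_family R \<beta> lR a
  for R :: "real \<Rightarrow> 'a::banach \<Rightarrow>\<^sub>L 'a" and \<beta> lR a +
  fixes c d L :: real and H :: "real \<Rightarrow> 'a \<Rightarrow> 'a"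
  assumes cd: "c < d" "d \<le> c + a" and L: "0 < L"
    and H_meas: "\<And>x. strongly_measurable (lebesgue_on {c..d}) (\<lambda>r. H r x)"
    and H_0: "bintegrable_on {c..d} (\<lambda>r. H r 0)"
    and H_lipschitz: "\<And>r x y. r \<in> {c..d} \<Longrightarrow> norm (H r x - H r y) \<le> L * norm (x - y)"
begin

text \<open>The Lipschitz condition gives linear growth, with
  \<open>norm (H r 0) + L * norm (z r)\<close> as integrable majorant.\<close>

lemma bintegrable_H:
  assumes z: "bintegrable_on {c..d} z"
  shows "bintegrable_on {c..d} (\<lambda>r. H r (z r))"
proof (rule bintegrable_on_bound)
  show "strongly_measurable (lebesgue_on {c..d}) (\<lambda>r. H r (z r))"
  proof (rule strongly_measurable_caratheodory[OF emeasure_lebesgue_on_interval_finite H_meas])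
    show "continuous_on UNIV (H r)" if "r \<in> space (lebesgue_on {c..d})" for r
    proof (rule lipschitz_on_continuous_on)
      show "L-lipschitz_on UNIV (H r)"
        using H_lipschitz[of r] that L by (intro lipschitz_onI) (auto simp: dist_norm)
    qed
  qed (rule bintegrable_on_measurable[OF z])
  show "bintegrable_on {c..d} (\<lambda>r. norm (H r 0) + L *\<^sub>R norm (z r))"
    by (intro bintegrable_on_add bintegrable_on_norm bintegrable_on_scaleR_const H_0 z)
  show "AE r in lebesgue_on {c..d}. norm (H r (z r)) \<le> norm (norm (H r 0) + L *\<^sub>R norm (z r))"
  proof (rule AE_lebesgue_on_interval)
    fix r assume "r \<in> {c<..<d}"
    then have "norm (H r (z r) - H r 0) \<le> L * norm (z r - 0)"
      by (intro H_lipschitz) auto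
    moreover have "norm (H r (z r)) \<le> norm (H r (z r) - H r 0) + norm (H r 0)"
      using norm_triangle_ineq[of "H r (z r) - H r 0" "H r 0"] by simp
    ultimately show "norm (H r (z r)) \<le> norm (norm (H r 0) + L *\<^sub>R norm (z r))"
      using L by simp
  qed
qed

definition V :: "(real \<Rightarrow> 'a) \<Rightarrow> real \<Rightarrow> 'a" where
  "V z s = bint_on {c..s} (\<lambda>r. S (s - r) (H r (z r)))"

lemma bintegrable_V:
  "bintegrable_on {c..d} z \<Longrightarrow> s \<in> {c..d} \<Longrightarrow> bintegrable_on {c..s} (\<lambda>r. S (s - r) (H r (z r)))"
  using bintegrable_S[OF bintegrable_H _ cd(2)] .

lemma continuous_V: "bintegrable_on {c..d} z \<Longrightarrow> continuous_on {c..d} (V z)"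
  unfolding V_def using continuous_on_bint_S[OF bintegrable_H cd(2)] .

lemma V_cong: "s \<in> {c..d} \<Longrightarrow> (\<And>r. r \<in> {c<..<d} \<Longrightarrow> y r = z r) \<Longrightarrow> V y s = V z s"
  unfolding V_def by (rule bint_on_interval_cong) auto

text \<open>Chosen so that \<open>M * L / lam\<close> is at most 1/2; the summand 1 keeps it
  positive when \<open>M = 0\<close>.\<close>

definition lam where "lam = 2 * M * L + 1"

lemma lam_pos: "0 < lam"
  unfolding lam_def using M_nonneg L by (simp add: add_nonneg_pos)

text \<open>Integrating \<open>exp (lam * (r - c))\<close> gains the factor \<open>1 / lam\<close>,
  which absorbs \<open>M * L\<close> regardless of its size. \<open>D\<close> stands for the
  weighted distance of \<open>y\<close> and \<open>z\<close>.\<close>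

lemma V_contraction:
  assumes y: "bintegrable_on {c..d} y" and z: "bintegrable_on {c..d} z" and s: "s \<in> {c..d}"
    and le: "\<And>r. r \<in> {c<..<d} \<Longrightarrow> norm (y r - z r) \<le> exp (lam * (r - c)) * D" and D: "0 \<le> D"
  shows "norm (V y s - V z s) \<le> 1/2 * exp (lam * (s - c)) * D"
proof -
  \<comment> \<open>An antiderivative of the majorant
    \<open>M * L * D * exp (lam * (r - c))\<close>.\<close>
  let ?F = "\<lambda>r. M * L * D / lam * exp (lam * (r - c))"
  have "norm (V y s - V z s) = norm (bint_on {c..s} (\<lambda>r. S (s - r) (H r (y r)) - S (s - r) (H r (z r))))"
    unfolding V_def by (subst bint_on_diff[OF bintegrable_V[OF y s] bintegrable_V[OF z s]]) simp
  also have "\<dots> \<le> ?F s - ?F c"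
  proof (rule bint_on_norm_le)
    show "bintegrable_on {c..s} (\<lambda>r. S (s - r) (H r (y r)) - S (s - r) (H r (z r)))"
      by (intro bintegrable_on_diff bintegrable_V y z s)
    show "((\<lambda>r. M * L * D * exp (lam * (r - c))) has_integral ?F s - ?F c) {c..s}"
    proof (rule fundamental_theorem_of_calculus)
      fix r
      have "(?F has_real_derivative M * L * D * exp (lam * (r - c))) (at r within {c..s})"
        using lam_pos by (auto intro!: derivative_eq_intros)
      then show "(?F has_vector_derivative M * L * D * exp (lam * (r - c))) (at r within {c..s})"
        by (simp add: has_real_derivative_iff_has_vector_derivative)
    qed (use s in auto)
    show "AE r in lebesgue_on {c..s}. norm (S (s - r) (H r (y r)) - S (s - r) (H r (z r))) \<le> M * L * D * exp (lam * (r - c))"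
    proof (rule AE_lebesgue_on_interval)
      fix r assume r: "r \<in> {c<..<s}"
      then have sr: "s - r \<in> {0..a}" using s cd by auto
      have "norm (S (s - r) (H r (y r)) - S (s - r) (H r (z r))) = norm (S (s - r) (H r (y r) - H r (z r)))"
        using sr by (simp add: S_diff)
      also have "\<dots> \<le> M * norm (H r (y r) - H r (z r))"
        by (rule norm_S_le[OF sr])
      also have "\<dots> \<le> M * (L * norm (y r - z r))"
        using r s by (intro mult_left_mono M_nonneg H_lipschitz) auto
      also have "\<dots> \<le> M * (L * (exp (lam * (r - c)) * D))"
        using r s L by (intro mult_left_mono M_nonneg le) auto
      finally show "norm (S (s - r) (H r (y r)) - S (s - r) (H r (z r))) \<le> M * L * D * exp (lam * (r - c))"
        by (simp add: mult_ac)
    qed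
  qed (use M_nonneg L D in auto)
  also have "\<dots> \<le> ?F s"
    using M_nonneg L D lam_pos by simp
  also have "\<dots> = (M * L / lam) * (exp (lam * (s - c)) * D)"
    by simp
  also have "\<dots> \<le> 1/2 * (exp (lam * (s - c)) * D)"
  proof (rule mult_right_mono)
    show "M * L / lam \<le> 1/2"
      using lam_pos unfolding lam_def by (simp add: divide_simps)
  qed (use D in simp)
  finally show ?thesis by (simp add: mult.assoc)
qed

text \<open>The remainder is written as \<open>w = e * v\<close> with \<open>e\<close> the
  exponential weight, so that the weighted norm of \<open>w\<close> is the plain supremum norm of
  \<open>v\<close>, and Banach's theorem applies in the complete space of bounded continuous
  functions.\<close>

lemma fixed_point:
  assumes f: "bintegrable_on {c..d} f"
  obtains w where "continuous_on {c..d} w" "\<And>s. s \<in> {c..d} \<Longrightarrow> w s = V (\<lambda>r. f r + w r) s"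
    "\<And>w'. \<lbrakk>continuous_on {c..d} w'; \<And>s. s \<in> {c..d} \<Longrightarrow> w' s = V (\<lambda>r. f r + w' r) s\<rbrakk>
       \<Longrightarrow> (\<And>s. s \<in> {c..d} \<Longrightarrow> w' s = w s)"
proof -
  \<comment> \<open>Bounded continuous functions live on the whole line; clamping the argument
    extends a function on \<open>[c, d]\<close> to them without changing its supremum norm.\<close>
  define cl where "cl s = max c (min d s)" for s
  have cl: "cl s \<in> {c..d}" for s using cd by (auto simp: cl_def)
  have cl_id: "s \<in> {c..d} \<Longrightarrow> cl s = s" for s by (auto simp: cl_def)
  have cl_cont: "continuous_on UNIV cl" unfolding cl_def by (intro continuous_intros)
  define e where "e s = exp (lam * (s - c))" for s
  have e_pos: "0 < e s" for s by (simp add: e_def)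
  have e_cont: "continuous_on A e" for A unfolding e_def by (intro continuous_intros)
  \<comment> \<open>The full unknown recovered from \<open>v\<close>; the possibly singular
    \<open>f\<close> is only integrated and never measured in the supremum norm.\<close>
  define Z where "Z v r = f r + e r *\<^sub>R apply_bcontfun v r" for v r
  have Z: "bintegrable_on {c..d} (Z v)" for v
    unfolding Z_def
    by (intro bintegrable_on_add f continuous_bintegrable_interval continuous_intros e_cont) auto
  have bc: "(\<lambda>s. (1 / e (cl s)) *\<^sub>R w (cl s)) \<in> bcontfun" if w: "continuous_on {c..d} w" for w :: "real \<Rightarrow> 'a"
  proof -
    have co: "continuous_on {c..d} (\<lambda>s. (1 / e s) *\<^sub>R w s)"
      using e_pos by (intro continuous_intros e_cont w) (auto simp: less_imp_neq[symmetric])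
    have "bounded ((\<lambda>s. (1 / e s) *\<^sub>R w s) ` {c..d})"
      using co by (intro compact_imp_bounded compact_continuous_image) auto
    then have "bounded (range (\<lambda>s. (1 / e (cl s)) *\<^sub>R w (cl s)))"
      by (rule bounded_subset) (use cl in auto)
    moreover have "continuous_on UNIV (\<lambda>s. (1 / e (cl s)) *\<^sub>R w (cl s))"
      by (rule continuous_on_compose2[OF co cl_cont]) (use cl in auto)
    ultimately show ?thesis
      by (simp add: bcontfun_def)
  qed
  define G where "G v = Bcontfun (\<lambda>s. (1 / e (cl s)) *\<^sub>R V (Z v) (cl s))" for v
  have G: "apply_bcontfun (G v) s = (1 / e (cl s)) *\<^sub>R V (Z v) (cl s)" for v s
    unfolding G_def by (subst Bcontfun_inverse[OF bc[OF continuous_V[OF Z]]]) simp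
  have "\<exists>!v. G v = v"
  proof (rule banach_fix_type[of "1/2"])
    show "\<forall>v v'. dist (G v) (G v') \<le> 1/2 * dist v v'"
    proof (intro allI dist_bound)
      fix v v' s
      have "norm (V (Z v) (cl s) - V (Z v') (cl s)) \<le> 1/2 * exp (lam * (cl s - c)) * dist v v'"
      proof (rule V_contraction[OF Z Z cl])
        fix r
        have "norm (Z v r - Z v' r) = e r * dist (apply_bcontfun v r) (apply_bcontfun v' r)"
          unfolding Z_def using e_pos[of r] by (simp add: dist_norm flip: scaleR_diff_right)
        also have "\<dots> \<le> e r * dist v v'"
          using e_pos[of r] by (intro mult_left_mono dist_bounded) auto
        finally show "norm (Z v r - Z v' r) \<le> exp (lam * (r - c)) * dist v v'"
          by (simp add: e_def)
      qed simp
      then have "1 / e (cl s) * norm (V (Z v) (cl s) - V (Z v') (cl s)) \<le> 1 / e (cl s) * (1/2 * e (cl s) * dist v v')"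
        using e_pos[of "cl s"] unfolding e_def by (intro mult_left_mono) auto
      then show "dist (apply_bcontfun (G v) s) (apply_bcontfun (G v') s) \<le> 1/2 * dist v v'"
        using e_pos[of "cl s"] unfolding G by (simp add: dist_norm flip: scaleR_diff_right)
    qed
  qed auto
  then obtain v where v: "G v = v" and uniq: "\<And>v'. G v' = v' \<Longrightarrow> v' = v" by blast
  define w where "w s = e s *\<^sub>R apply_bcontfun v s" for s
  have w_eq: "w s = V (\<lambda>r. f r + w r) s" if "s \<in> {c..d}" for s
  proof -
    have "apply_bcontfun v s = (1 / e s) *\<^sub>R V (Z v) s"
      using G[of v s] cl_id[OF that] v by simp
    then show ?thesis
      using e_pos[of s] unfolding w_def Z_def by simp
  qed
  show thesis
  proof
    show "continuous_on {c..d} w"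
      unfolding w_def by (intro continuous_intros e_cont) auto
    show "w s = V (\<lambda>r. f r + w r) s" if "s \<in> {c..d}" for s
      by (rule w_eq[OF that])
    fix w' s assume w': "continuous_on {c..d} w'" "\<And>s. s \<in> {c..d} \<Longrightarrow> w' s = V (\<lambda>r. f r + w' r) s"
      and s: "s \<in> {c..d}"
    define v' where "v' = Bcontfun (\<lambda>s. (1 / e (cl s)) *\<^sub>R w' (cl s))"
    have v': "apply_bcontfun v' s = (1 / e (cl s)) *\<^sub>R w' (cl s)" for s
      unfolding v'_def by (subst Bcontfun_inverse[OF bc[OF w'(1)]]) simp
    have "G v' = v'"
    proof (rule bcontfun_eqI)
      fix x
      \<comment> \<open>Undoing the weight recovers \<open>w'\<close> only inside the interval,
        where the clamp is the identity; \<open>V\<close> sees no other values.\<close>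
      have "V (Z v') (cl x) = V (\<lambda>r. f r + w' r) (cl x)"
      proof (rule V_cong[OF cl])
        fix r assume "r \<in> {c<..<d}"
        then show "Z v' r = f r + w' r"
          unfolding Z_def v' using cl_id[of r] e_pos[of r] by simp
      qed
      also have "\<dots> = w' (cl x)"
        using w'(2)[OF cl] by simp
      finally show "apply_bcontfun (G v') x = apply_bcontfun v' x"
        unfolding G v' by simp
    qed
    then have "v' = v" by (rule uniq)
    then show "w' s = w s"
      using v'[of s] cl_id[OF s] e_pos[of s] unfolding w_def by simp
  qed
qed

text \<open>Uniqueness holds among all integrable functions: \<open>V\<close> smooths, so for any
  integrable solution \<open>y\<close> the remainder \<open>V y\<close> is automatically continuous
  and competes in \<open>fixed_point\<close>.\<close>

lemma solution:
  assumes f: "bintegrable_on {c..d} f"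
  obtains z where "bintegrable_on {c..d} z" "\<And>s. s \<in> {c<..d} \<Longrightarrow> z s = f s + V z s"
    "\<And>y s. \<lbrakk>bintegrable_on {c..d} y; \<And>s. s \<in> {c<..d} \<Longrightarrow> y s = f s + V y s; s \<in> {c<..d}\<rbrakk>
       \<Longrightarrow> y s = z s"
proof -
  obtain w where w: "continuous_on {c..d} w" "\<And>s. s \<in> {c..d} \<Longrightarrow> w s = V (\<lambda>r. f r + w r) s"
    and uniq: "\<And>w' s. \<lbrakk>continuous_on {c..d} w'; \<And>s. s \<in> {c..d} \<Longrightarrow> w' s = V (\<lambda>r. f r + w' r) s;
       s \<in> {c..d}\<rbrakk> \<Longrightarrow> w' s = w s"
    using fixed_point[OF f, of thesis] by blast
  show thesis
  proof
    show "bintegrable_on {c..d} (\<lambda>r. f r + w r)"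
      by (intro bintegrable_on_add f continuous_bintegrable_interval w)
    show "f s + w s = f s + V (\<lambda>r. f r + w r) s" if "s \<in> {c<..d}" for s
      using w(2)[of s] that by simp
    fix y s assume y: "bintegrable_on {c..d} y" "\<And>s. s \<in> {c<..d} \<Longrightarrow> y s = f s + V y s" and s: "s \<in> {c<..d}"
    \<comment> \<open>Substituting the equation for \<open>y\<close> under the integral shows that
      \<open>V y\<close> solves the remainder equation.\<close>
    have "V y x = V (\<lambda>r. f r + V y r) x" if "x \<in> {c..d}" for x
      by (rule V_cong[OF that]) (use y(2) in auto)
    then have "V y s = w s"
      by (intro uniq continuous_V y) (use s in auto)
    then show "y s = f s + w s"
      using y(2)[OF s] by simp
  qed
qed

end

section \<open>The impulsive system\<close>

text \<open>For \<open>s\<close> beyond \<open>d\<close> the kernel is not singular on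
  \<open>[c, d]\<close>; its largest value is the one at \<open>r = d\<close>.\<close>

lemma bintegrable_on_history_kernel:
  fixes z :: "real \<Rightarrow> 'a::banach"
  assumes z: "bintegrable_on {c..d} z" and p: "0 \<le> p" and s: "d < s"
  shows "bintegrable_on {c..d} (\<lambda>r. (1 / (s - r) powr p) *\<^sub>R z r)"
proof (rule bintegrable_on_bound)
  have "continuous_on {c<..<d} (\<lambda>r. 1 / (s - r) powr p)"
    using s by (intro continuous_intros) auto
  then show "strongly_measurable (lebesgue_on {c..d}) (\<lambda>r. (1 / (s - r) powr p) *\<^sub>R z r)"
    by (intro strongly_measurable_scaleR strongly_measurable_continuous_interval bintegrable_on_measurable[OF z])
  show "bintegrable_on {c..d} (\<lambda>r. (1 / (s - d) powr p) *\<^sub>R z r)"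
    by (rule bintegrable_on_scaleR_const[OF z])
  show "AE r in lebesgue_on {c..d}. norm ((1 / (s - r) powr p) *\<^sub>R z r) \<le> norm ((1 / (s - d) powr p) *\<^sub>R z r)"
  proof (rule AE_lebesgue_on_interval)
    fix r assume r: "r \<in> {c<..<d}"
    have "1 / (s - r) powr p \<le> 1 / (s - d) powr p"
      using s r p by (intro divide_left_mono powr_mono2 mult_pos_pos) auto
    then show "norm ((1 / (s - r) powr p) *\<^sub>R z r) \<le> norm ((1 / (s - d) powr p) *\<^sub>R z r)"
      by (simp add: mult_right_mono del: times_divide_eq_left)
  qed
qed

lemma continuous_on_history_kernel:
  fixes z :: "real \<Rightarrow> 'a::banach"
  assumes z: "bintegrable_on {c..d} z" and p: "0 \<le> p" and e: "d \<le> e"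
  shows "continuous_on {e<..} (\<lambda>s. bint_on {c..d} (\<lambda>r. (1 / (s - r) powr p) *\<^sub>R z r))"
proof -
  \<comment> \<open>A majorant uniform in \<open>s\<close> exists only at positive distance from
    \<open>e\<close>, since \<open>e = d\<close> is possible. Continuity is therefore shown on each
    ray from \<open>b > e\<close>, and these open rays cover the claim.\<close>
  have "continuous_on {b<..} (\<lambda>s. bint_on {c..d} (\<lambda>r. (1 / (s - r) powr p) *\<^sub>R z r))" if b: "e < b" for b
    unfolding continuous_on_sequentially
  proof (intro allI ballI impI)
    fix x :: "nat \<Rightarrow> real" and s
    assume s: "s \<in> {b<..}" and "(\<forall>n. x n \<in> {b<..}) \<and> x \<longlonglongrightarrow> s"
    then have x: "\<And>n. b < x n" and lim: "x \<longlonglongrightarrow> s" by auto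
    have "(\<lambda>n. bint_on {c..d} (\<lambda>r. (1 / (x n - r) powr p) *\<^sub>R z r))
        \<longlonglongrightarrow> bint_on {c..d} (\<lambda>r. (1 / (s - r) powr p) *\<^sub>R z r)"
    proof (rule bint_on_dominated_convergence)
      show "bintegrable_on {c..d} (\<lambda>r. (1 / (b - d) powr p) *\<^sub>R z r)"
        by (rule bintegrable_on_scaleR_const[OF z])
      show "strongly_measurable (lebesgue_on {c..d}) (\<lambda>r. (1 / (x n - r) powr p) *\<^sub>R z r)" for n
        using x[of n] b e by (intro bintegrable_on_measurable bintegrable_on_history_kernel[OF z p]) auto
      show "strongly_measurable (lebesgue_on {c..d}) (\<lambda>r. (1 / (s - r) powr p) *\<^sub>R z r)"
        using s b e by (intro bintegrable_on_measurable bintegrable_on_history_kernel[OF z p]) auto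
      show "AE r in lebesgue_on {c..d}. norm ((1 / (x n - r) powr p) *\<^sub>R z r) \<le> norm ((1 / (b - d) powr p) *\<^sub>R z r)" for n
      proof (rule AE_lebesgue_on_interval)
        fix r assume r: "r \<in> {c<..<d}"
        have "1 / (x n - r) powr p \<le> 1 / (b - d) powr p"
          using x[of n] b e r p by (intro divide_left_mono powr_mono2 mult_pos_pos) auto
        then show "norm ((1 / (x n - r) powr p) *\<^sub>R z r) \<le> norm ((1 / (b - d) powr p) *\<^sub>R z r)"
          by (simp add: mult_right_mono del: times_divide_eq_left)
      qed
      show "AE r in lebesgue_on {c..d}. (\<lambda>n. (1 / (x n - r) powr p) *\<^sub>R z r) \<longlonglongrightarrow> (1 / (s - r) powr p) *\<^sub>R z r"
        by (intro AE_lebesgue_on_interval tendsto_intros lim) (use s b e in auto)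
    qed
    then show "((\<lambda>s. bint_on {c..d} (\<lambda>r. (1 / (s - r) powr p) *\<^sub>R z r)) \<circ> x)
        \<longlonglongrightarrow> bint_on {c..d} (\<lambda>r. (1 / (s - r) powr p) *\<^sub>R z r)"
      by (simp add: comp_def)
  qed
  then have "continuous_on (\<Union>b\<in>{e<..}. {b<..}) (\<lambda>s. bint_on {c..d} (\<lambda>r. (1 / (s - r) powr p) *\<^sub>R z r))"
    by (intro continuous_on_open_UN) auto
  moreover have "{e<..} \<subseteq> (\<Union>b\<in>{e<..}. {b<..})"
    using dense by auto
  ultimately show ?thesis
    by (rule continuous_on_subset)
qed

lemma continuous_on_Ioc_left_limit:
  fixes z :: "real \<Rightarrow> 'a::topological_space"
  assumes "continuous_on {c<..d} z" "c < d"
  shows "(z \<longlongrightarrow> z d) (at_left d)"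
proof -
  have "at d within {c<..d} = at_left d"
    using assms(2) by (intro at_within_nhd[of d "{c<..}"]) auto
  moreover have "(z \<longlongrightarrow> z d) (at d within {c<..d})"
    using assms by (auto simp: continuous_on)
  ultimately show ?thesis by simp
qed

text \<open>On a finite measure space Lq lies in L1, because a nonnegative number is at most 1 plus
  its \<open>q\<close>-th power.\<close>

lemma Lq_space_bintegrable:
  fixes f :: "real \<Rightarrow> 'a::banach"
  assumes f: "f \<in> Lq_space q {c..d}" and q: "1 \<le> q"
  shows "bintegrable_on {c..d} f"
proof -
  let ?M = "lebesgue_on {c..d}"
  have fm: "strongly_measurable ?M f" and fin: "(\<integral>\<^sup>+x. ennreal (norm (f x) powr q) \<partial>?M) < \<infinity>"
    using f unfolding Lq_space_def by auto
  obtain g where g: "g \<in> borel_measurable ?M" "AE x in ?M. norm (f x) = g x" "\<And>x. 0 \<le> g x"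
    using strongly_measurable_norm_AE[OF fm, of thesis] by blast
  have "(\<integral>\<^sup>+x. ennreal (norm (f x)) \<partial>?M) = (\<integral>\<^sup>+x. ennreal (g x) \<partial>?M)"
    using g(2) by (intro nn_integral_cong_AE) auto
  also have "\<dots> \<le> (\<integral>\<^sup>+x. 1 + ennreal (g x powr q) \<partial>?M)"
  proof (rule nn_integral_mono)
    fix x
    have "g x \<le> 1 + g x powr q"
    proof (cases "g x \<le> 1")
      case False
      then show ?thesis using powr_mono[of 1 q "g x"] q by simp
    qed (simp add: add_increasing2)
    from ennreal_leI[OF this] show "ennreal (g x) \<le> 1 + ennreal (g x powr q)"
      by (simp add: ennreal_plus)
  qed
  also have "\<dots> = (\<integral>\<^sup>+x. 1 \<partial>?M) + (\<integral>\<^sup>+x. ennreal (g x powr q) \<partial>?M)"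
    using g(1) by (intro nn_integral_add) auto
  also have "(\<integral>\<^sup>+x. ennreal (g x powr q) \<partial>?M) = (\<integral>\<^sup>+x. ennreal (norm (f x) powr q) \<partial>?M)"
    using g(2) by (intro nn_integral_cong_AE) auto
  also have "(\<integral>\<^sup>+x. 1 \<partial>?M) + (\<integral>\<^sup>+x. ennreal (norm (f x) powr q) \<partial>?M) < \<infinity>"
    using fin emeasure_lebesgue_on_interval_finite[of c d] by (simp add: ennreal_add_less_top)
  finally show ?thesis
    using fm unfolding bintegrable_on_iff by simp
qed

text \<open>Turns an asymptotic order at the right endpoint into a bound on the whole interval: away
  from \<open>d\<close> both sides are controlled by compactness.\<close>

lemma bigo_at_left_imp_bound:
  fixes f :: "real \<Rightarrow> 'a::real_normed_vector"
  assumes cd: "c < d" and f: "continuous_on {c..d} f" and fd: "f d = 0"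
    and O: "(\<lambda>s. norm (f s)) \<in> O[at_left d](\<lambda>s. (d - s) powr p)" and p: "0 \<le> p"
  shows "\<exists>B\<ge>0. \<forall>s\<in>{c..d}. norm (f s) \<le> B * (d - s) powr p"
proof -
  obtain K where K: "K > 0" "\<forall>\<^sub>F s in at_left d. norm (norm (f s)) \<le> K * norm ((d - s) powr p)"
    using landau_o.bigE[OF O, of thesis] by blast
  then obtain b where b: "b < d" "\<And>s. b < s \<Longrightarrow> s < d \<Longrightarrow> norm (f s) \<le> K * (d - s) powr p"
    using eventually_at_left[OF cd] by auto
  obtain C where C: "0 \<le> C" "\<And>x. x \<in> {c..d} \<Longrightarrow> norm (f x) \<le> C"
    using continuous_interval_bounded[OF f, of thesis] by blast
  \<comment> \<open>\<open>K\<close> serves the points between \<open>b\<close> and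
    \<open>d\<close>; the second summand serves the points up to \<open>b\<close>, where
    \<open>(d - s) powr p\<close> is at least \<open>(d - b) powr p\<close>.\<close>
  define B where "B = K + C / (d - b) powr p"
  have B: "K \<le> B" "C / (d - b) powr p \<le> B" "0 \<le> B"
    using K(1) C(1) by (auto simp: B_def)
  have "norm (f s) \<le> B * (d - s) powr p" if s: "s \<in> {c..d}" for s
  proof -
    consider "s = d" | "b < s" "s < d" | "s \<le> b" using s by force
    then show ?thesis
    proof cases
      case 2
      then show ?thesis
        using order.trans[OF b(2)[of s] mult_right_mono[OF B(1)]] by simp
    next
      case 3
      have "(d - b) powr p \<le> (d - s) powr p"
        using 3 b(1) p by (intro powr_mono2) auto
      then have "C / (d - b) powr p * (d - b) powr p \<le> B * (d - s) powr p"
        using B by (intro mult_mono) auto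
      then show ?thesis
        using C(2)[OF s] b(1) by simp
    qed (simp add: fd)
  qed
  then show ?thesis using B(3) by blast
qed

text \<open>The constant in \<open>phi_bound\<close> may depend on the state \<open>x\<close>, since
  the history term uses each impulse at the single state \<open>z (t k)\<close>.\<close>

locale impulsive_system = singular_family R \<beta> lR a
  for R :: "real \<Rightarrow> 'a::banach \<Rightarrow>\<^sub>L 'a" and \<beta> lR a +
  fixes m :: nat and u t :: "nat \<Rightarrow> real" and h :: "real \<Rightarrow> 'a \<Rightarrow> 'a" and lh :: real
    and \<phi> :: "nat \<Rightarrow> real \<Rightarrow> 'a \<Rightarrow> 'a" and z0 :: 'a and zt :: "nat \<Rightarrow> 'a"
  assumes beta2: "\<beta> < 2" and points: "partition_points m a u t"
    and h_meas: "\<And>x. strongly_measurable (lebesgue_on {0..a}) (\<lambda>s. h s x)"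
    and h_0: "bintegrable_on {0..a} (\<lambda>s. h s 0)"
    and lh: "0 < lh"
    and h_lipschitz: "\<And>s x y. s \<in> {0..a} \<Longrightarrow> norm (h s x - h s y) \<le> lh * norm (x - y)"
    and phi_cont: "\<And>j x. j \<in> {1..m} \<Longrightarrow> continuous_on {t j..u j} (\<lambda>s. \<phi> j s x)"
    and phi_bound: "\<And>j x. j \<in> {1..m} \<Longrightarrow>
      \<exists>B\<ge>0. \<forall>s\<in>{t j..u j}. norm (\<phi> j s x) \<le> B * (u j - s) powr (1 + \<beta>)"
begin

lemma u_0: "u 0 = 0"
  and u_less_t: "j \<le> m \<Longrightarrow> u j < t (Suc j)"
  and t_less_u: "1 \<le> j \<Longrightarrow> j \<le> m \<Longrightarrow> t j < u j"
  and t_last: "t (Suc m) = a" and u_last: "u (Suc m) = a"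
  using points unfolding partition_points_def by auto

text \<open>At \<open>j = m\<close> both sides are \<open>a\<close>; the weak inequality is what
  holds uniformly in \<open>j\<close>.\<close>

lemma t_le_u: "j \<le> m \<Longrightarrow> t (Suc j) \<le> u (Suc j)"
  using t_less_u[of "Suc j"] t_last u_last by (cases "j = m") auto

lemma u_mono: "i \<le> j \<Longrightarrow> j \<le> Suc m \<Longrightarrow> u i \<le> u j"
proof (induction rule: dec_induct)
  case (step n)
  then show ?case
    using u_less_t[of n] t_le_u[of n] by auto
qed simp

lemma t_mono: "i \<le> j \<Longrightarrow> j \<le> m \<Longrightarrow> t (Suc i) \<le> t (Suc j)"
proof (induction rule: dec_induct)
  case (step n)
  then show ?case
    using t_le_u[of n] u_less_t[of "Suc n"] by auto
qed simp

lemma u_nonneg: "j \<le> Suc m \<Longrightarrow> 0 \<le> u j"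
  using u_mono[of 0 j] u_0 by simp

lemma t_le_a: "j \<le> m \<Longrightarrow> t (Suc j) \<le> a"
  using t_le_u[of j] u_mono[of "Suc j" "Suc m"] u_last by simp

lemma t_pos: "j \<le> m \<Longrightarrow> 0 < t (Suc j)"
  using u_less_t[of j] u_nonneg[of j] by simp

section \<open>The history term\<close>

abbreviation "Phi \<equiv> Phi_hist \<beta> u t \<phi>"

text \<open>Lets the first interval be treated by the same equation as the later ones.\<close>

lemma Phi_0: "Phi 0 z s = 0"
  by (simp add: Phi_hist_def)

lemma phi_bintegrable: "j \<in> {1..m} \<Longrightarrow> bintegrable_on {t j..u j} (\<lambda>r. \<phi> j r x)"
  by (intro continuous_bintegrable_interval phi_cont)

text \<open>The last history interval ends exactly at \<open>u j\<close>, so the ray has to be open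
  there.\<close>

lemma Phi_continuous:
  assumes j: "j \<le> m" and z: "\<And>k. k < j \<Longrightarrow> bintegrable_on {u k..t (Suc k)} z"
  shows "continuous_on {u j<..} (Phi j z)"
proof -
  have "continuous_on {u j<..} (\<lambda>s. bint_on {u k..t (k + 1)} (\<lambda>r. (1 / (s - r) powr (1 + \<beta>)) *\<^sub>R z r))"
    if "k < j" for k
    using that j z[OF that] beta t_le_u[of k] u_mono[of "Suc k" j]
    by (intro continuous_on_history_kernel) auto
  moreover have "continuous_on {u j<..} (\<lambda>s. bint_on {t (k + 1)..u (k + 1)}
      (\<lambda>r. (1 / (s - r) powr (1 + \<beta>)) *\<^sub>R \<phi> (k + 1) r (z (t (k + 1)))))" if "k < j" for k
    using that j beta phi_bintegrable[of "Suc k"] u_mono[of "Suc k" j]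
    by (intro continuous_on_history_kernel) auto
  ultimately show ?thesis
    unfolding Phi_hist_def[abs_def] by (intro continuous_intros) auto
qed

text \<open>Makes \<open>Phi j z\<close> integrable on the next interval, as the term
  \<open>H r 0\<close> of the Volterra equation demands. The integrals of \<open>z\<close> stay away
  from \<open>s\<close>; those of the impulses may reach up to \<open>u j\<close>, and there
  \<open>phi_bound\<close> compensates the kernel.\<close>

lemma Phi_bounded:
  assumes j: "j \<le> m" and z: "\<And>k. k < j \<Longrightarrow> bintegrable_on {u k..t (Suc k)} z"
  obtains B where "\<And>s. u j < s \<Longrightarrow> norm (Phi j z s) \<le> B"
proof -
  define F where "F k s = bint_on {u k..t (k + 1)} (\<lambda>r. (1 / (s - r) powr (1 + \<beta>)) *\<^sub>R z r)
           + bint_on {t (k + 1)..u (k + 1)}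
               (\<lambda>r. (1 / (s - r) powr (1 + \<beta>)) *\<^sub>R \<phi> (k + 1) r (z (t (k + 1))))" for k s
  have "\<exists>B. \<forall>s>u j. norm (F k s) \<le> B" if k: "k < j" for k
  proof -
    have tu: "t (Suc k) < u (Suc k)" "u (Suc k) \<le> u j"
      using k j t_less_u[of "Suc k"] u_mono[of "Suc k" j] by auto
    \<comment> \<open>On \<open>[u k, t (Suc k)]\<close> the distance \<open>s - r\<close> is at
      least the length of the impulse interval that follows.\<close>
    define c where "c = 1 / (u (Suc k) - t (Suc k)) powr (1 + \<beta>)"
    obtain N where N: "\<And>f :: real \<Rightarrow> 'a. \<And>c. \<lbrakk>bintegrable_on {u k..t (Suc k)} f; 0 \<le> c;
      AE x in lebesgue_on {u k..t (Suc k)}. norm (f x) \<le> c * norm (z x)\<rbrakk> \<Longrightarrow> norm (bint_on {u k..t (Suc k)} f) \<le> c * N"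
      using bint_on_norm_le_const_mult[OF z[OF k], where 'a = 'a, of thesis] by blast
    have 1: "norm (bint_on {u k..t (Suc k)} (\<lambda>r. (1 / (s - r) powr (1 + \<beta>)) *\<^sub>R z r)) \<le> c * N" if s: "u j < s" for s
    proof (rule N)
      show "bintegrable_on {u k..t (Suc k)} (\<lambda>r. (1 / (s - r) powr (1 + \<beta>)) *\<^sub>R z r)"
        using s tu beta by (intro bintegrable_on_history_kernel z k) auto
      show "AE r in lebesgue_on {u k..t (Suc k)}. norm ((1 / (s - r) powr (1 + \<beta>)) *\<^sub>R z r) \<le> c * norm (z r)"
      proof (rule AE_lebesgue_on_interval)
        fix r assume r: "r \<in> {u k<..<t (Suc k)}"
        have "1 / (s - r) powr (1 + \<beta>) \<le> c"
          unfolding c_def using s tu beta r by (intro divide_left_mono powr_mono2 mult_pos_pos) auto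
        then show "norm ((1 / (s - r) powr (1 + \<beta>)) *\<^sub>R z r) \<le> c * norm (z r)"
          by (simp add: mult_right_mono del: times_divide_eq_left)
      qed
    qed (simp add: c_def)
    obtain B where B: "0 \<le> B" "\<And>r. r \<in> {t (Suc k)..u (Suc k)} \<Longrightarrow>
        norm (\<phi> (Suc k) r (z (t (Suc k)))) \<le> B * (u (Suc k) - r) powr (1 + \<beta>)"
      using phi_bound[of "Suc k" "z (t (Suc k))"] k j by auto
    have 2: "norm (bint_on {t (Suc k)..u (Suc k)} (\<lambda>r. (1 / (s - r) powr (1 + \<beta>)) *\<^sub>R \<phi> (Suc k) r (z (t (Suc k)))))
        \<le> B * (u (Suc k) - t (Suc k))" if s: "u j < s" for s
    proof (rule bint_on_norm_le)
      show "bintegrable_on {t (Suc k)..u (Suc k)} (\<lambda>r. (1 / (s - r) powr (1 + \<beta>)) *\<^sub>R \<phi> (Suc k) r (z (t (Suc k))))"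
        using s tu beta k j by (intro bintegrable_on_history_kernel phi_bintegrable) auto
      show "((\<lambda>_. B) has_integral B * (u (Suc k) - t (Suc k))) {t (Suc k)..u (Suc k)}"
        using has_integral_const_real[of B "t (Suc k)" "u (Suc k)"] tu by (simp add: mult.commute)
      show "AE r in lebesgue_on {t (Suc k)..u (Suc k)}.
          norm ((1 / (s - r) powr (1 + \<beta>)) *\<^sub>R \<phi> (Suc k) r (z (t (Suc k)))) \<le> B"
      proof (rule AE_lebesgue_on_interval)
        fix r assume r: "r \<in> {t (Suc k)<..<u (Suc k)}"
        have "norm (\<phi> (Suc k) r (z (t (Suc k)))) \<le> B * (u (Suc k) - r) powr (1 + \<beta>)"
          using B(2) r by auto
        \<comment> \<open>Since \<open>u (Suc k)\<close> lies below \<open>s\<close>, the vanishing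
          order \<open>1 + \<beta>\<close> cancels the kernel exactly and leaves
          \<open>B\<close>.\<close>
        also have "\<dots> \<le> B * (s - r) powr (1 + \<beta>)"
          using r s tu beta B(1) by (intro mult_left_mono powr_mono2) auto
        finally show "norm ((1 / (s - r) powr (1 + \<beta>)) *\<^sub>R \<phi> (Suc k) r (z (t (Suc k)))) \<le> B"
          using r s tu by (simp add: divide_simps)
      qed
    qed (use B(1) in auto)
    have "norm (F k s) \<le> c * N + B * (u (Suc k) - t (Suc k))" if "u j < s" for s
      unfolding F_def using norm_triangle_mono[OF 1[OF that] 2[OF that]] by simp
    then show ?thesis by blast
  qed
  then have "\<forall>k\<in>{..<j}. \<exists>B. \<forall>s>u j. norm (F k s) \<le> B" by auto
  from bchoice[OF this] obtain B where B: "\<And>k s. k < j \<Longrightarrow> u j < s \<Longrightarrow> norm (F k s) \<le> B k" by auto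
  show thesis
  proof (rule that)
    fix s assume s: "u j < s"
    have "norm (Phi j z s) = \<bar>\<beta> * (\<beta> - 1) / Gamma (2 - \<beta>)\<bar> * norm (\<Sum>k<j. F k s)"
      unfolding Phi_hist_def F_def by simp
    also have "\<dots> \<le> \<bar>\<beta> * (\<beta> - 1) / Gamma (2 - \<beta>)\<bar> * (\<Sum>k<j. B k)"
      using B s by (intro mult_left_mono order.trans[OF norm_sum] sum_mono) auto
    finally show "norm (Phi j z s) \<le> \<bar>\<beta> * (\<beta> - 1) / Gamma (2 - \<beta>)\<bar> * (\<Sum>k<j. B k)" .
  qed
qed

lemma Phi_cong:
  assumes j: "j \<le> m" and eq: "\<And>s i. i < j \<Longrightarrow> s \<in> {0<..t (Suc i)} \<Longrightarrow> y s = z s"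
  shows "Phi j y s = Phi j z s"
proof -
  have "bint_on {u k..t (k + 1)} (\<lambda>r. (1 / (s - r) powr (1 + \<beta>)) *\<^sub>R y r)
      = bint_on {u k..t (k + 1)} (\<lambda>r. (1 / (s - r) powr (1 + \<beta>)) *\<^sub>R z r)" if "k < j" for k
    using that j u_nonneg[of k] by (intro bint_on_interval_cong) (auto simp: eq[of k])
  moreover have "y (t (k + 1)) = z (t (k + 1))" if "k < j" for k
    using that j t_pos[of k] eq[of k "t (Suc k)"] by auto
  ultimately show ?thesis
    unfolding Phi_hist_def by (intro arg_cong[where f = "\<lambda>x. _ *\<^sub>R x"] sum.cong) auto
qed

section \<open>The equation on one evolution interval\<close>

definition initial :: "nat \<Rightarrow> (real \<Rightarrow> 'a) \<Rightarrow> 'a" where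
  "initial j z = (if j = 0 then z0
     else (1 / (u j - t j)) *\<^sub>R bint_on {t j..u j} (\<lambda>r. \<phi> j r (z (t j))))"

text \<open>The known part \<open>f\<close> of the Volterra equation; it depends on \<open>z\<close>
  only through \<open>z (t j)\<close>.\<close>

definition forcing :: "nat \<Rightarrow> (real \<Rightarrow> 'a) \<Rightarrow> real \<Rightarrow> 'a" where
  "forcing j z s = blinfun_apply (R (s - u j)) (initial j z)
     + bint_on {u j..s} (\<lambda>r. blinfun_apply (R (r - u j)) (zt j))"

text \<open>The weight of the \<open>PC_space\<close> norm moved to the right-hand side, on the
  evolution part of the interval from \<open>u j\<close> to \<open>u (Suc j)\<close> only; the
  remainder of that interval belongs to the impulse.\<close>

definition weighted_bounded :: "nat \<Rightarrow> (real \<Rightarrow> 'a) \<Rightarrow> bool" where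
  "weighted_bounded j z \<longleftrightarrow> (\<exists>B. \<forall>s\<in>{u j<..t (Suc j)}. norm (z s) \<le> B * (s - u j) powr (\<beta> - 2))"

lemma weighted_bounded_bintegrable:
  assumes "weighted_bounded j z" and z: "continuous_on {u j<..<t (Suc j)} z"
  shows "bintegrable_on {u j..t (Suc j)} z"
proof -
  obtain B where B: "\<And>s. s \<in> {u j<..t (Suc j)} \<Longrightarrow> norm (z s) \<le> B * (s - u j) powr (\<beta> - 2)"
    using assms unfolding weighted_bounded_def by blast
  show ?thesis
  proof (rule bintegrable_on_bound)
    show "bintegrable_on {u j..t (Suc j)} (\<lambda>s. B *\<^sub>R (s - u j) powr (\<beta> - 2))"
      using beta by (intro bintegrable_on_scaleR_const bintegrable_on_powr) auto
    show "AE s in lebesgue_on {u j..t (Suc j)}. norm (z s) \<le> norm (B *\<^sub>R (s - u j) powr (\<beta> - 2))"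
    proof (rule AE_lebesgue_on_interval)
      fix s assume "s \<in> {u j<..<t (Suc j)}"
      then have "norm (z s) \<le> B * (s - u j) powr (\<beta> - 2)" by (intro B) auto
      also have "\<dots> \<le> \<bar>B * (s - u j) powr (\<beta> - 2)\<bar>" by (rule abs_ge_self)
      finally show "norm (z s) \<le> norm (B *\<^sub>R (s - u j) powr (\<beta> - 2))" by simp
    qed
  qed (rule strongly_measurable_continuous_interval[OF z])
qed

lemma weighted_bounded_add:
  assumes "weighted_bounded j y" "weighted_bounded j z"
  shows "weighted_bounded j (\<lambda>s. y s + z s)"
proof -
  obtain B where B: "\<And>s. s \<in> {u j<..t (Suc j)} \<Longrightarrow> norm (y s) \<le> B * (s - u j) powr (\<beta> - 2)"
    using assms(1) unfolding weighted_bounded_def by blast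
  obtain C where C: "\<And>s. s \<in> {u j<..t (Suc j)} \<Longrightarrow> norm (z s) \<le> C * (s - u j) powr (\<beta> - 2)"
    using assms(2) unfolding weighted_bounded_def by blast
  have "norm (y s + z s) \<le> (B + C) * (s - u j) powr (\<beta> - 2)" if "s \<in> {u j<..t (Suc j)}" for s
    using norm_triangle_mono[OF B[OF that] C[OF that]] by (simp add: distrib_right)
  then show ?thesis unfolding weighted_bounded_def by blast
qed

text \<open>As \<open>s - u j\<close> is at most \<open>a\<close> and \<open>\<beta> - 2\<close> is
  negative, \<open>(s - u j) powr (\<beta> - 2)\<close> is bounded below by
  \<open>a powr (\<beta> - 2)\<close>, so every bounded function is dominated.\<close>

lemma weighted_bounded_continuous:
  assumes j: "j \<le> m" and z: "continuous_on {u j..t (Suc j)} z"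
  shows "weighted_bounded j z"
proof -
  obtain B where B: "0 \<le> B" "\<And>x. x \<in> {u j..t (Suc j)} \<Longrightarrow> norm (z x) \<le> B"
    using continuous_interval_bounded[OF z, of thesis] by blast
  have "norm (z s) \<le> (B * a powr (2 - \<beta>)) * (s - u j) powr (\<beta> - 2)" if s: "s \<in> {u j<..t (Suc j)}" for s
  proof -
    have "a powr (\<beta> - 2) \<le> (s - u j) powr (\<beta> - 2)"
      using s beta2 t_le_a[OF j] u_nonneg[of j] j by (intro powr_mono2') auto
    then have "a powr (2 - \<beta>) * a powr (\<beta> - 2) \<le> a powr (2 - \<beta>) * (s - u j) powr (\<beta> - 2)"
      by (intro mult_left_mono) auto
    then have "1 \<le> a powr (2 - \<beta>) * (s - u j) powr (\<beta> - 2)"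
      using a_pos by (simp add: powr_add[symmetric])
    then have "B * 1 \<le> B * (a powr (2 - \<beta>) * (s - u j) powr (\<beta> - 2))"
      using B(1) by (rule mult_left_mono)
    then show ?thesis
      using B(2)[of s] s by (simp add: mult.assoc)
  qed
  then show ?thesis unfolding weighted_bounded_def by blast
qed

lemma interval_length: "j \<le> m \<Longrightarrow> t (Suc j) \<le> u j + a"
  using t_le_a[of j] u_nonneg[of j] by simp

lemma forcing_continuous:
  assumes j: "j \<le> m"
  shows "continuous_on {u j<..t (Suc j)} (forcing j z)"
proof -
  have "continuous_on {u j<..t (Suc j)} (\<lambda>s. blinfun_apply (R (s - u j)) (initial j z))"
    by (intro continuous_on_compose2[OF continuous_R] continuous_intros) auto
  moreover have "continuous_on {u j<..t (Suc j)} (\<lambda>s. bint_on {u j..s} (\<lambda>r. blinfun_apply (R (r - u j)) (zt j)))"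
    by (rule continuous_on_subset[OF continuous_on_bint_R]) (use interval_length[OF j] in auto)
  ultimately show ?thesis
    unfolding forcing_def[abs_def] by (rule continuous_on_add)
qed

lemma forcing_weighted_bounded:
  assumes j: "j \<le> m"
  shows "weighted_bounded j (forcing j z)"
  unfolding forcing_def[abs_def]
proof (rule weighted_bounded_add)
  have "norm (blinfun_apply (R (s - u j)) (initial j z)) \<le> lR * norm (initial j z) * (s - u j) powr (\<beta> - 2)"
    if "s \<in> {u j<..t (Suc j)}" for s
    using that interval_length[OF j] by (intro norm_R_le) auto
  then show "weighted_bounded j (\<lambda>s. blinfun_apply (R (s - u j)) (initial j z))"
    unfolding weighted_bounded_def by blast
  show "weighted_bounded j (\<lambda>s. bint_on {u j..s} (\<lambda>r. blinfun_apply (R (r - u j)) (zt j)))"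
    by (intro weighted_bounded_continuous[OF j] continuous_on_subset[OF continuous_on_bint_R])
      (use interval_length[OF j] in auto)
qed

lemma forcing_bintegrable:
  "j \<le> m \<Longrightarrow> bintegrable_on {u j..t (Suc j)} (forcing j z)"
  by (intro weighted_bounded_bintegrable forcing_weighted_bounded
      continuous_on_subset[OF forcing_continuous]) auto

lemma volterra:
  assumes j: "j \<le> m" and z: "\<And>k. k < j \<Longrightarrow> bintegrable_on {u k..t (Suc k)} z"
  shows "volterra_equation R \<beta> lR a (u j) (t (Suc j)) lh (\<lambda>r x. h r x - Phi j z r)"
proof unfold_locales
  have P: "strongly_measurable (lebesgue_on {u j..t (Suc j)}) (Phi j z)"
    by (intro strongly_measurable_continuous_interval continuous_on_subset[OF Phi_continuous[OF j z]]) auto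
  have sub: "{u j..t (Suc j)} \<subseteq> {0..a}"
    using t_le_a[OF j] u_nonneg[of j] j by auto
  have "strongly_measurable (lebesgue_on {u j..t (Suc j)}) (\<lambda>r. h r x)" for x
    by (rule strongly_measurable_lebesgue_on_subset[OF h_meas sub]) auto
  then show "strongly_measurable (lebesgue_on {u j..t (Suc j)}) (\<lambda>r. h r x - Phi j z r)" for x
    by (intro strongly_measurable_diff P)
  obtain B where "\<And>s. u j < s \<Longrightarrow> norm (Phi j z s) \<le> B"
    using Phi_bounded[OF j z, where thesis = thesis] by blast
  then have "bintegrable_on {u j..t (Suc j)} (Phi j z)"
    by (intro bintegrable_on_bounded[OF P]) auto
  moreover have "bintegrable_on {u j..t (Suc j)} (\<lambda>r. h r 0)"
    by (rule bintegrable_on_subset[OF h_0 sub]) auto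
  ultimately show "bintegrable_on {u j..t (Suc j)} (\<lambda>r. h r 0 - Phi j z r)"
    by (intro bintegrable_on_diff)
  show "norm ((h r x - Phi j z r) - (h r y - Phi j z r)) \<le> lh * norm (x - y)"
    if "r \<in> {u j..t (Suc j)}" for r x y
    using h_lipschitz[of r x y] that sub by auto
qed (use j u_less_t lh interval_length in auto)

text \<open>The past \<open>z\<close> and the unknown \<open>w\<close> are separate arguments: with
  \<open>z\<close> given, this is a Volterra equation for \<open>w\<close> with known data, and
  taking \<open>w = z\<close> returns the equation of the mild solution.\<close>

definition piece_equation :: "nat \<Rightarrow> (real \<Rightarrow> 'a) \<Rightarrow> (real \<Rightarrow> 'a) \<Rightarrow> bool" where
  "piece_equation j z w \<longleftrightarrow> (\<forall>s\<in>{u j<..t (Suc j)}.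
     w s = forcing j z s + bint_on {u j..s} (\<lambda>r. S (s - r) (h r (w r) - Phi j z r)))"

text \<open>Regularity from integrability: the Volterra integral of an integrable \<open>w\<close>
  is continuous up to \<open>u j\<close>, so \<open>w\<close> inherits continuity and the order of
  the singularity from the forcing term.\<close>

lemma piece_continuous:
  assumes j: "j \<le> m" and z: "\<And>k. k < j \<Longrightarrow> bintegrable_on {u k..t (Suc k)} z"
    and w: "bintegrable_on {u j..t (Suc j)} w" "piece_equation j z w"
  shows "continuous_on {u j<..t (Suc j)} w" "weighted_bounded j w"
proof -
  interpret V: volterra_equation R \<beta> lR a "u j" "t (Suc j)" lh "\<lambda>r x. h r x - Phi j z r"
    by (rule volterra[OF j z])
  have eq: "w s = forcing j z s + V.V w s" if "s \<in> {u j<..t (Suc j)}" for s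
    using w(2) that unfolding piece_equation_def V.V_def by blast
  have "continuous_on {u j<..t (Suc j)} (\<lambda>s. forcing j z s + V.V w s)"
    by (intro continuous_on_add forcing_continuous j continuous_on_subset[OF V.continuous_V[OF w(1)]]) auto
  then show "continuous_on {u j<..t (Suc j)} w"
    by (rule continuous_on_eq) (simp add: eq)
  have "weighted_bounded j (\<lambda>s. forcing j z s + V.V w s)"
    by (intro weighted_bounded_add forcing_weighted_bounded j weighted_bounded_continuous V.continuous_V w)
  then show "weighted_bounded j w"
    unfolding weighted_bounded_def by (simp add: eq)
qed

lemma piece_bintegrable:
  assumes j: "j \<le> m" and z: "\<And>k. k < j \<Longrightarrow> bintegrable_on {u k..t (Suc k)} z"
    and w: "bintegrable_on {u j..t (Suc j)} w" and s: "s \<in> {u j<..t (Suc j)}"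
  shows "bintegrable_on {u j..s} (\<lambda>r. S (s - r) (h r (w r) - Phi j z r))"
proof -
  interpret V: volterra_equation R \<beta> lR a "u j" "t (Suc j)" lh "\<lambda>r x. h r x - Phi j z r"
    by (rule volterra[OF j z])
  show ?thesis
    using V.bintegrable_V[OF w, of s] s by auto
qed

lemma piece_exists:
  assumes j: "j \<le> m" and z: "\<And>k. k < j \<Longrightarrow> bintegrable_on {u k..t (Suc k)} z"
  obtains w where "bintegrable_on {u j..t (Suc j)} w" "piece_equation j z w"
proof -
  interpret V: volterra_equation R \<beta> lR a "u j" "t (Suc j)" lh "\<lambda>r x. h r x - Phi j z r"
    by (rule volterra[OF j z])
  obtain w where "bintegrable_on {u j..t (Suc j)} w"
      "\<And>s. s \<in> {u j<..t (Suc j)} \<Longrightarrow> w s = forcing j z s + V.V w s"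
    using V.solution[OF forcing_bintegrable[OF j], of z thesis] by blast
  then show thesis
    using that[of w] unfolding piece_equation_def V.V_def by blast
qed

lemma piece_unique:
  assumes j: "j \<le> m" and z: "\<And>k. k < j \<Longrightarrow> bintegrable_on {u k..t (Suc k)} z"
    and w: "bintegrable_on {u j..t (Suc j)} w" "piece_equation j z w"
    and y: "bintegrable_on {u j..t (Suc j)} y" "piece_equation j z y"
    and s: "s \<in> {u j<..t (Suc j)}"
  shows "y s = w s"
proof -
  interpret V: volterra_equation R \<beta> lR a "u j" "t (Suc j)" lh "\<lambda>r x. h r x - Phi j z r"
    by (rule volterra[OF j z])
  have eq: "w s = forcing j z s + V.V w s" "y s = forcing j z s + V.V y s"
    if "s \<in> {u j<..t (Suc j)}" for s
    using w(2) y(2) that unfolding piece_equation_def V.V_def by blast+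
  obtain x where x: "\<And>y s. \<lbrakk>bintegrable_on {u j..t (Suc j)} y;
      \<And>s. s \<in> {u j<..t (Suc j)} \<Longrightarrow> y s = forcing j z s + V.V y s; s \<in> {u j<..t (Suc j)}\<rbrakk> \<Longrightarrow> y s = x s"
    using V.solution[OF forcing_bintegrable[OF j], of z thesis] by blast
  show ?thesis
    using x[OF w(1) eq(1) s] x[OF y(1) eq(2) s] by simp
qed

section \<open>Gluing the pieces\<close>

text \<open>A form of the mild solution suited to induction over the pieces with index below
  \<open>n\<close>, thus for times up to \<open>t n\<close>. Integrability on each piece stands in
  for membership in \<open>PC_space\<close>, and the value \<open>z (t j)\<close> for the left
  limit.\<close>

definition solves :: "nat \<Rightarrow> (real \<Rightarrow> 'a) \<Rightarrow> bool" where
  "solves n z \<longleftrightarrow> (\<forall>j<n. bintegrable_on {u j..t (Suc j)} z \<and> piece_equation j z z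
     \<and> (0 < j \<longrightarrow> (\<forall>s\<in>{t j<..u j}. z s = \<phi> j s (z (t j)))))"

lemma initial_cong: "z (t j) = y (t j) \<Longrightarrow> initial j z = initial j y"
  unfolding initial_def by simp

text \<open>Both the past and the unknown may be exchanged, because the equation sees only times up
  to \<open>t j\<close> and the interval itself. Gluing and uniqueness both rely on this.\<close>

lemma piece_equation_cong:
  assumes j: "j \<le> m" and eq: "\<And>s i. i < j \<Longrightarrow> s \<in> {0<..t (Suc i)} \<Longrightarrow> y s = z s"
    and w: "\<And>s. s \<in> {u j<..t (Suc j)} \<Longrightarrow> w s = x s" and pe: "piece_equation j y w"
  shows "piece_equation j z x"
  unfolding piece_equation_def
proof
  fix s assume s: "s \<in> {u j<..t (Suc j)}"
  have "initial j y = initial j z"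
  proof (cases j)
    case (Suc i)
    then show ?thesis
      using eq[of i "t j"] t_pos[of i] j by (intro initial_cong) auto
  qed (simp add: initial_def)
  then have "forcing j y s = forcing j z s"
    by (simp add: forcing_def)
  moreover have "bint_on {u j..s} (\<lambda>r. S (s - r) (h r (w r) - Phi j y r))
      = bint_on {u j..s} (\<lambda>r. S (s - r) (h r (x r) - Phi j z r))"
  proof (rule bint_on_interval_cong)
    fix r assume "r \<in> {u j<..<s}"
    then have "w r = x r" using s by (intro w) auto
    moreover have "Phi j y r = Phi j z r"
      using eq by (intro Phi_cong j) auto
    ultimately show "S (s - r) (h r (w r) - Phi j y r) = S (s - r) (h r (x r) - Phi j z r)" by simp
  qed
  ultimately show "x s = forcing j z s + bint_on {u j..s} (\<lambda>r. S (s - r) (h r (x r) - Phi j z r))"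
    using pe s w[OF s] unfolding piece_equation_def by auto
qed

lemma solves_exists: "n \<le> Suc m \<Longrightarrow> \<exists>z. solves n z"
proof (induction n)
  case 0
  then show ?case by (simp add: solves_def)
next
  case (Suc n)
  then obtain z where z: "solves n z" by auto
  have n: "n \<le> m" using Suc.prems by simp
  have zi: "bintegrable_on {u k..t (Suc k)} z" if "k < n" for k
    using z that unfolding solves_def by blast
  obtain w where w: "bintegrable_on {u n..t (Suc n)} w" "piece_equation n z w"
    using piece_exists[OF n zi, where thesis = thesis] by blast
  \<comment> \<open>Old solution up to \<open>t n\<close>, impulse up to \<open>u n\<close>, new
    piece afterwards. The case \<open>n = 0\<close> is separate since there is no impulse and
    \<open>t 0\<close> is an unconstrained value.\<close>
  define y where "y s = (if s \<le> u n then (if n = 0 \<or> s \<le> t n then z s else \<phi> n s (z (t n))) else w s)" for s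
  have y_z: "y s = z s" if "i < n" "s \<le> t (Suc i)" for i s
  proof -
    have "t (Suc i) \<le> t n" "t n \<le> u n"
      using that(1) n t_mono[of i "n - 1"] t_less_u[of n] by auto
    then show ?thesis
      using that by (simp add: y_def)
  qed
  have "bintegrable_on {u j..t (Suc j)} y \<and> piece_equation j y y
     \<and> (0 < j \<longrightarrow> (\<forall>s\<in>{t j<..u j}. y s = \<phi> j s (y (t j))))" if j: "j < Suc n" for j
  proof (cases "j < n")
    case True
    have "bintegrable_on {u j..t (Suc j)} y"
      using zi[OF True] y_z[OF True] by (subst bint_on_interval_cong(2)[of _ _ _ z]) auto
    moreover have "piece_equation j y y"
    proof (rule piece_equation_cong)
      show "piece_equation j z z"
        using z True unfolding solves_def by blast
      show "z s = y s" if "i < j" "s \<in> {0<..t (Suc i)}" for s i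
        using y_z[of i s] that True by simp
    qed (use True n y_z in auto)
    moreover have "y s = \<phi> j s (y (t j))" if "0 < j" "s \<in> {t j<..u j}" for s
    proof -
      have "s \<le> t (Suc j)" "t j \<le> t (Suc j)"
        using that u_less_t[of j] t_less_u[of j] True n by auto
      then show ?thesis
        using y_z[OF True] z True that unfolding solves_def by simp
    qed
    ultimately show ?thesis by blast
  next
    case False
    then have jn: "j = n" using j by simp
    have "bintegrable_on {u n..t (Suc n)} y"
      using w(1) by (subst bint_on_interval_cong(2)[of _ _ _ w]) (auto simp: y_def)
    moreover have "piece_equation n y y"
      by (rule piece_equation_cong[OF n _ _ w(2)]) (use y_z in \<open>auto simp: y_def\<close>)
    moreover have "y s = \<phi> n s (y (t n))" if "0 < n" "s \<in> {t n<..u n}" for s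
      using that t_less_u[of n] n by (auto simp: y_def)
    ultimately show ?thesis
      unfolding jn by blast
  qed
  then show ?case
    unfolding solves_def by blast
qed

text \<open>Once two solutions agree up to \<open>t j\<close>, the impulse formula makes them agree
  up to \<open>u j\<close>, and then both solve one and the same Volterra equation.\<close>

lemma solves_unique:
  assumes y: "solves (Suc m) y" and z: "solves (Suc m) z"
  shows "j \<le> m \<Longrightarrow> s \<in> {0<..t (Suc j)} \<Longrightarrow> y s = z s"
proof (induction j arbitrary: s rule: less_induct)
  case (less j)
  have zi: "bintegrable_on {u k..t (Suc k)} z" "piece_equation k z z"
    and yi: "bintegrable_on {u k..t (Suc k)} y" "piece_equation k y y" if "k \<le> m" for k
    using y z that unfolding solves_def by auto
  have eq: "y s = z s" if "i < j" "s \<in> {0<..t (Suc i)}" for i s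
    using less.IH[of i s] that less.prems by auto
  show ?case
  proof (cases "u j < s")
    case True
    show ?thesis
    proof (rule piece_unique[OF less.prems(1)])
      \<comment> \<open>The equation of \<open>y\<close> has \<open>y\<close> as its past; by the
        induction hypothesis this past can be replaced by \<open>z\<close>.\<close>
      show "piece_equation j z y"
        by (rule piece_equation_cong[OF less.prems(1) _ _ yi(2)]) (use eq less.prems in auto)
      show "piece_equation j z z" by (rule zi(2)[OF less.prems(1)])
    qed (use zi yi less.prems True in auto)
  next
    case False
    then have "j \<noteq> 0"
      using less.prems u_0 by (intro notI) auto
    then obtain i where i: "j = Suc i" by (cases j) auto
    show ?thesis
    proof (cases "s \<le> t j")
      case True
      then show ?thesis using eq[of i s] i less.prems by auto
    next
      case nle: False
      have "y (t j) = z (t j)"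
        using eq[of i "t j"] t_pos[of i] i less.prems by auto
      moreover have "y s = \<phi> j s (y (t j))" "z s = \<phi> j s (z (t j))"
        using y z nle False i less.prems unfolding solves_def by auto
      ultimately show ?thesis by simp
    qed
  qed
qed

section \<open>Equivalence with mild solutions\<close>

text \<open>The weighted bound of \<open>PC_space\<close> has the integrable majorant
  \<open>(s - u j) powr (\<beta> - 2)\<close>, and its left limit condition at \<open>t j\<close>
  identifies \<open>Lim\<close> with the value \<open>z (t j)\<close>.\<close>

lemma mild_solution_imp_solves:
  assumes "mild_solution \<beta> m u t R h \<phi> z0 zt z"
  shows "solves (Suc m) z"
  unfolding solves_def
proof (intro allI impI)
  fix j assume "j < Suc m"
  then have j: "j \<le> m" by simp
  have PC: "z \<in> PC_space \<beta> m u t"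
    using assms unfolding mild_solution_def by blast
  have "bdd_above ((\<lambda>s. (s - u j) powr (2 - \<beta>) * norm (z s)) ` {u j<..u (Suc j)})"
    using PC j unfolding PC_space_def by auto
  then obtain B where B: "\<And>s. s \<in> {u j<..u (Suc j)} \<Longrightarrow> (s - u j) powr (2 - \<beta>) * norm (z s) \<le> B"
    unfolding bdd_above_def by blast
  have "weighted_bounded j z"
    unfolding weighted_bounded_def
  proof (intro exI ballI)
    fix s assume s: "s \<in> {u j<..t (Suc j)}"
    have "(s - u j) powr (2 - \<beta>) * norm (z s) \<le> B"
      using s t_le_u[OF j] by (intro B) auto
    then have "((s - u j) powr (2 - \<beta>) * norm (z s)) * (s - u j) powr (\<beta> - 2) \<le> B * (s - u j) powr (\<beta> - 2)"
      by (rule mult_right_mono) simp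
    also have "((s - u j) powr (2 - \<beta>) * norm (z s)) * (s - u j) powr (\<beta> - 2)
        = ((s - u j) powr (2 - \<beta>) * (s - u j) powr (\<beta> - 2)) * norm (z s)"
      by simp
    also have "\<dots> = norm (z s)"
      using s by (simp add: powr_add[symmetric])
    finally show "norm (z s) \<le> B * (s - u j) powr (\<beta> - 2)" .
  qed
  moreover have "continuous_on {u j<..<t (Suc j)} z"
    using PC j unfolding PC_space_def by (auto elim!: continuous_on_subset)
  ultimately have "bintegrable_on {u j..t (Suc j)} z"
    by (rule weighted_bounded_bintegrable)
  moreover have "piece_equation j z z"
  proof (cases "j = 0")
    case True
    then show ?thesis
      using assms unfolding mild_solution_def piece_equation_def forcing_def initial_def S_def
      by (simp add: u_0 Phi_0)
  next
    case False
    then show ?thesis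
      using assms j unfolding mild_solution_def piece_equation_def forcing_def initial_def S_def
      by (simp add: blinfun.scaleR_right)
  qed
  moreover have "z s = \<phi> j s (z (t j))" if "0 < j" "s \<in> {t j<..u j}" for s
  proof -
    have "(z \<longlongrightarrow> z (t j)) (at_left (t j))"
      using PC j that unfolding PC_space_def by auto
    then have "Lim (at_left (t j)) z = z (t j)"
      by (intro tendsto_Lim) auto
    moreover have "z s = \<phi> j s (Lim (at_left (t j)) z)"
      using assms j that unfolding mild_solution_def by simp
    ultimately show ?thesis by simp
  qed
  ultimately show "bintegrable_on {u j..t (Suc j)} z \<and> piece_equation j z z
     \<and> (0 < j \<longrightarrow> (\<forall>s\<in>{t j<..u j}. z s = \<phi> j s (z (t j))))" by blast
qed

text \<open>Membership in \<open>PC_space\<close> is regained from \<open>piece_continuous\<close>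
  on the evolution intervals and from continuity of the impulses between them;
  \<open>piece_bintegrable\<close> supplies the required existence of the integrals.\<close>

lemma solves_imp_mild_solution:
  assumes "solves (Suc m) z"
  shows "mild_solution \<beta> m u t R h \<phi> z0 zt z"
proof -
  have zi: "bintegrable_on {u k..t (Suc k)} z" and ze: "piece_equation k z z" if "k \<le> m" for k
    using assms that unfolding solves_def by auto
  have zphi: "z s = \<phi> k s (z (t k))" if "k \<in> {1..m}" "s \<in> {t k<..u k}" for k s
    using assms that unfolding solves_def by auto
  have cont: "continuous_on {u k<..t (Suc k)} z" and bdd: "weighted_bounded k z" if "k \<le> m" for k
    using piece_continuous[OF that zi zi ze] that by auto
  have t_left: "(z \<longlongrightarrow> z (t j)) (at_left (t j))" if j: "j \<in> {1..m}" for j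
  proof -
    obtain i where i: "j = Suc i" "i \<le> m" "u i < t j"
      using j u_less_t[of "j - 1"] by (cases j) auto
    show ?thesis
      using continuous_on_Ioc_left_limit[OF cont[OF i(2)]] i by simp
  qed
  have phi_cont': "continuous_on {t j<..u j} z" if j: "j \<in> {1..m}" for j
    by (rule continuous_on_eq[OF continuous_on_subset[OF phi_cont[OF j]]]) (use zphi[OF j] in auto)
  have u_left: "(z \<longlongrightarrow> z (u j)) (at_left (u j))" if j: "j \<in> {1..m}" for j
    using continuous_on_Ioc_left_limit[OF phi_cont'[OF j]] j t_less_u by auto
  have "continuous_on ((\<Union>j\<in>{0..m}. {u j<..<t (j + 1)}) \<union> (\<Union>j\<in>{1..m}. {t j<..<u j})) z"
  proof (rule continuous_on_open_Un)
    show "continuous_on (\<Union>j\<in>{0..m}. {u j<..<t (j + 1)}) z"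
    proof (rule continuous_on_open_UN)
      show "continuous_on {u j<..<t (j + 1)} z" if "j \<in> {0..m}" for j
        by (rule continuous_on_subset[OF cont[of j]]) (use that in auto)
    qed auto
    show "continuous_on (\<Union>j\<in>{1..m}. {t j<..<u j}) z"
    proof (rule continuous_on_open_UN)
      show "continuous_on {t j<..<u j} z" if "j \<in> {1..m}" for j
        by (rule continuous_on_subset[OF phi_cont'[OF that]]) auto
    qed auto
  qed auto
  moreover have "bdd_above ((\<lambda>s. (s - u j) powr (2 - \<beta>) * norm (z s)) ` {u j<..u (j + 1)})"
    if "j \<in> {0..m}" for j
  proof -
    have j: "j \<le> m" using that by simp
    obtain B where B: "\<And>s. s \<in> {u j<..t (Suc j)} \<Longrightarrow> norm (z s) \<le> B * (s - u j) powr (\<beta> - 2)"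
      using bdd[OF j] unfolding weighted_bounded_def by blast
    have 1: "(s - u j) powr (2 - \<beta>) * norm (z s) \<le> B" if s: "s \<in> {u j<..t (Suc j)}" for s
    proof -
      have "(s - u j) powr (2 - \<beta>) * norm (z s) \<le> (s - u j) powr (2 - \<beta>) * (B * (s - u j) powr (\<beta> - 2))"
        by (intro mult_left_mono B s) simp
      also have "\<dots> = B * ((s - u j) powr (2 - \<beta>) * (s - u j) powr (\<beta> - 2))"
        by simp
      also have "\<dots> = B"
        using s by (simp add: powr_add[symmetric])
      finally show ?thesis .
    qed
    show ?thesis
    \<comment> \<open>The last interval ends at \<open>t (Suc m) = u (Suc m)\<close> and contains no
      impulse; on the others the impulse part is bounded by compactness.\<close>
    proof (cases "j = m")
      case True
      then show ?thesis
        using 1 t_last u_last by (intro bdd_aboveI[of _ B]) auto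
    next
      case False
      then have Sj: "Suc j \<in> {1..m}" using j by auto
      obtain C where C: "0 \<le> C" "\<And>s. s \<in> {t (Suc j)..u (Suc j)} \<Longrightarrow> norm (\<phi> (Suc j) s (z (t (Suc j)))) \<le> C"
        using continuous_interval_bounded[OF phi_cont[OF Sj], where thesis = thesis] by blast
      have 2: "(s - u j) powr (2 - \<beta>) * norm (z s) \<le> (u (Suc j) - u j) powr (2 - \<beta>) * C"
        if s: "s \<in> {t (Suc j)<..u (Suc j)}" for s
      proof (rule mult_mono)
        show "norm (z s) \<le> C"
          using C(2)[of s] zphi[OF Sj s] s by simp
        show "(s - u j) powr (2 - \<beta>) \<le> (u (Suc j) - u j) powr (2 - \<beta>)"
          using s beta2 u_less_t[OF j] by (intro powr_mono2) auto
      qed auto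
      show ?thesis
      proof (rule bdd_aboveI)
        fix x assume "x \<in> (\<lambda>s. (s - u j) powr (2 - \<beta>) * norm (z s)) ` {u j<..u (j + 1)}"
        then obtain s where s: "s \<in> {u j<..u (Suc j)}" "x = (s - u j) powr (2 - \<beta>) * norm (z s)" by auto
        show "x \<le> max B ((u (Suc j) - u j) powr (2 - \<beta>) * C)"
          using 1[of s] 2[of s] s by (cases "s \<le> t (Suc j)") auto
      qed
    qed
  qed
  ultimately have "z \<in> PC_space \<beta> m u t"
    unfolding PC_space_def by (intro CollectI conjI ballI t_left u_left)
  moreover have "bintegrable_on {0..s} (\<lambda>r. bint_on {0..s - r} (\<lambda>p. blinfun_apply (R p) (h r (z r))))
      \<and> z s = blinfun_apply (R s) z0
            + bint_on {0..s} (\<lambda>r. blinfun_apply (R r) (zt 0))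
            + bint_on {0..s} (\<lambda>r. bint_on {0..s - r} (\<lambda>p. blinfun_apply (R p) (h r (z r))))"
    if "s \<in> {0<..t 1}" for s
    using ze[of 0] piece_bintegrable[OF _ _ zi, of 0 z s] that
    unfolding piece_equation_def forcing_def initial_def S_def by (simp add: u_0 Phi_0)
  moreover have "z s = \<phi> j s (Lim (at_left (t j)) z)" if "j \<in> {1..m}" "s \<in> {t j<..u j}" for j s
    using zphi[OF that] tendsto_Lim[OF _ t_left[OF that(1)]] by simp
  moreover have "bintegrable_on {u j..s} (\<lambda>r. bint_on {0..s - r}
          (\<lambda>p. blinfun_apply (R p) (h r (z r) - Phi_hist \<beta> u t \<phi> j z r))) \<and>
        z s = (1 / (u j - t j)) *\<^sub>R
                blinfun_apply (R (s - u j)) (bint_on {t j..u j} (\<lambda>r. \<phi> j r (z (t j))))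
            + bint_on {u j..s} (\<lambda>r. blinfun_apply (R (r - u j)) (zt j))
            + bint_on {u j..s} (\<lambda>r. bint_on {0..s - r}
                (\<lambda>p. blinfun_apply (R p) (h r (z r) - Phi_hist \<beta> u t \<phi> j z r)))"
    if "j \<in> {1..m}" "s \<in> {u j<..t (j + 1)}" for j s
    using ze[of j] piece_bintegrable[OF _ zi zi, of j s] that
    unfolding piece_equation_def forcing_def initial_def S_def by (simp add: blinfun.scaleR_right)
  ultimately show ?thesis
    unfolding mild_solution_def by blast
qed

text \<open>Agreement is asserted on times after 0, because the value at 0 is fixed neither by the
  equation nor by \<open>PC_space\<close>.\<close>

theorem unique_mild_solution:
  "\<exists>z. mild_solution \<beta> m u t R h \<phi> z0 zt z \<and>
    (\<forall>y. mild_solution \<beta> m u t R h \<phi> z0 zt y \<longrightarrow> (\<forall>s\<in>{0<..a}. y s = z s))"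
proof -
  obtain z where z: "solves (Suc m) z"
    using solves_exists by blast
  have "y s = z s" if "mild_solution \<beta> m u t R h \<phi> z0 zt y" "s \<in> {0<..a}" for y s
    using solves_unique[OF mild_solution_imp_solves[OF that(1)] z, of m s] that(2) t_last by simp
  with solves_imp_mild_solution[OF z] show ?thesis by blast
qed

end

theorem theorem4p1:
  fixes \<beta> a q lR lh :: real
    and m :: nat
    and u t l\<phi> l\<psi> :: "nat \<Rightarrow> real"
    and R :: "real \<Rightarrow> 'a::banach \<Rightarrow>\<^sub>L 'a"
    and D :: "'a set" and A :: "'a \<Rightarrow> 'a"
    and h :: "real \<Rightarrow> 'a \<Rightarrow> 'a"
    and \<phi> \<psi> :: "nat \<Rightarrow> real \<Rightarrow> 'a \<Rightarrow> 'a"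
    and z0 :: 'a and zt :: "nat \<Rightarrow> 'a"
  assumes beta: "1 < \<beta>" "\<beta> < 2"
    and m: "1 \<le> m"
    and points: "partition_points m a u t"
    and resolvent: "rl_resolvent \<beta> R"
    and generator: "rl_generator \<beta> R D A"
    and R_bound: "\<And>s. s \<in> {0<..a} \<Longrightarrow> norm (s powr (2 - \<beta>) *\<^sub>R R s) \<le> lR"
    and A1: "1 \<le> q" "q < 1 / (2 - \<beta>)"
    and h_Lq: "\<And>x. (\<lambda>s. h s x) \<in> Lq_space q {0..a}"
    and A2: "lh > 0"
      "\<And>s x y. s \<in> {0..a} \<Longrightarrow> norm (h s x - h s y) \<le> lh * norm (x - y)"
    and A3: "\<And>j. j \<in> {1..m} \<Longrightarrow> continuous_on ({t j..u j} \<times> UNIV) (\<lambda>(s, x). \<phi> j s x)"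
      "\<And>j. j \<in> {1..m} \<Longrightarrow> l\<phi> j \<in> {0<..1}"
      "\<And>j s x y. j \<in> {1..m} \<Longrightarrow> s \<in> {t j..u j} \<Longrightarrow>
         norm (\<phi> j s x - \<phi> j s y) \<le> l\<phi> j * norm (x - y)"
    and A4: "\<And>j x. j \<in> {1..m} \<Longrightarrow>
         (\<lambda>s. norm (\<phi> j s x)) \<in> O[at_left (u j)](\<lambda>s. (u j - s) powr (1 + \<beta>))"
      "\<And>j s x. j \<in> {1..m} \<Longrightarrow> s \<in> {t j..u j} \<Longrightarrow>
         \<phi> j s x = (u j - s) powr (1 + \<beta>) *\<^sub>R \<psi> j s x"
      "\<And>j. j \<in> {1..m} \<Longrightarrow> l\<psi> j \<in> {0<..1}"
      "\<And>j s x y. j \<in> {1..m} \<Longrightarrow> s \<in> {t j..u j} \<Longrightarrow>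
         norm (\<psi> j s x - \<psi> j s y) \<le> l\<psi> j * norm (x - y)"
    and A5: "\<And>j. j \<in> {1..m} \<Longrightarrow> contraction_const \<beta> u t lR lh l\<phi> l\<psi> j < 1"
  shows "\<exists>z. mild_solution \<beta> m u t R h \<phi> z0 zt z \<and>
           (\<forall>y. mild_solution \<beta> m u t R h \<phi> z0 zt y \<longrightarrow> (\<forall>s\<in>{0<..a}. y s = z s))"
proof -
  have tu: "t j < u j" if "j \<in> {1..m}" for j
    using points that unfolding partition_points_def by auto
  have a_pos: "0 < a"
  proof -
    \<comment> \<open>Downward induction from \<open>u m < t (m + 1) = a\<close>, since the
      partition data compare only neighbouring points; \<open>j = 0\<close> gives the claim.\<close>
    have "u j < a" if "j \<le> m" for j
      using that
    proof (induction rule: inc_induct)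
      case base
      then show ?case using points unfolding partition_points_def by auto
    next
      case (step n)
      then have "u n < t (n + 1)" "t (Suc n) < u (Suc n)"
        using points unfolding partition_points_def by auto
      then show ?case using step.IH by simp
    qed
    from this[of 0] show ?thesis
      using points unfolding partition_points_def by simp
  qed
  interpret impulsive_system R \<beta> lR a m u t h lh \<phi> z0 zt
  proof unfold_locales
    show "continuous_on {0<..} (\<lambda>s. blinfun_apply (R s) v)" for v
      using resolvent unfolding rl_resolvent_def by blast
    show "strongly_measurable (lebesgue_on {0..a}) (\<lambda>s. h s x)" for x
      using h_Lq[of x] unfolding Lq_space_def by blast
    show "bintegrable_on {0..a} (\<lambda>s. h s 0)"
      by (rule Lq_space_bintegrable[OF h_Lq A1(1)])
    show phi: "continuous_on {t j..u j} (\<lambda>s. \<phi> j s x)" if "j \<in> {1..m}" for j x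
    proof -
      have "continuous_on {t j..u j} (\<lambda>s. case (s, x) of (s, x) \<Rightarrow> \<phi> j s x)"
        by (rule continuous_on_compose2[OF A3(1)[OF that]]) (auto intro!: continuous_intros)
      then show ?thesis by simp
    qed
    \<comment> \<open>The order at \<open>at_left (u j)\<close> says nothing about the point
      \<open>u j\<close> itself; there the factorisation through \<open>\<psi>\<close> gives the
      value 0.\<close>
    show "\<exists>B\<ge>0. \<forall>s\<in>{t j..u j}. norm (\<phi> j s x) \<le> B * (u j - s) powr (1 + \<beta>)" if j: "j \<in> {1..m}" for j x
      using A4(2)[OF j, of "u j" x] tu[OF j] beta
      by (intro bigo_at_left_imp_bound phi A4(1) j) auto
  qed (use beta a_pos R_bound A2 points in auto)
  show ?thesis
    by (rule unique_mild_solution)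
qed

end
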